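(* Let $\mu$ be a probability measure on $\mathbb{R}$ satisfying the standing assumptions below and $\int_{\mathbb{R}}|x|\,d\mu<+\infty$, with support interval $I$; assume moreover that either $\mu$ has compact support or there exists $\delta>0$ with $\int_{\mathbb{R}}|x|^{2+\delta}d\mu<+\infty$. Let $\vec X_n$ be a vector of $n$ i.i.d. variables with law $\mu$ and $\vec v\in(0,1)^k$ a percentile vector. Then \[ \Bigg|\frac{\mathbb{E}[SC_{\vec v}(\vec X_n)]}{\mathbb{E}[SC_{opt}(\vec X_n)]}-\frac{W_1(\mu,\nu_{Q_{\vec v}})}{W_1(\mu,\nu^{(k)})}\Bigg|\le O(n^{-1/2}), \] and there exists $C>0$ such that \[ B^{(n)}_{ar}(\mathcal{PM}_{\vec v})\le \frac{W_1(\mu,\nu_{Q_{\vec v}})}{W_1(\mu,\nu^{(k)})}+\frac{C}{\sqrt n}\qquad\text{for all } n>k, \] where $\nu^{(k)}$ is a minimizer of $\min_{\lambda\in\mathcal{P}_k(\mathbb{R})}W_1(\mu,\lambda)$ and $\nu_{Q_{\vec v}}=\sum_{i=1}^k(F_\mu(z_i)-F_\mu(z_{i-1}))\delta_{F_\mu^{[-1]}(v_i)}$ with $z_i=\frac{F_\mu^{[-1]}(v_i)+F_\mu^{[-1]}(v_{i+1})}{2}$ ($1\le i\le k-1$), $z_0=\inf I$, $z_k=\sup I$.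
   Context: For $\vec x\in\mathbb{R}^n$, $\vec y\in\mathbb{R}^k$: $SC(\vec x,\vec y)=\frac1n\sum_i\min_j|x_i-y_j|$, $SC_{opt}(\vec x)=\min_{\vec y}SC(\vec x,\vec y)$. A percentile vector is $\vec v$ with $0\le v_1\le\dots\le v_k\le1$; the percentile mechanism $\mathcal{PM}_{\vec v}$ sorts the reports $x_{(1)}\le\dots\le x_{(n)}$ and places facility $j$ at $x_{(\lfloor(n-1)v_j\rfloor+1)}$; $SC_{\vec v}(\vec x)$ is the Social Cost of its output. The Bayesian approximation ratio is $B^{(n)}_{ar}(f)=\mathbb{E}[SC_f(\vec X_n)]/\mathbb{E}[SC_{opt}(\vec X_n)]$. $\mathcal{P}_k(\mathbb{R})$: probability measures $\sum_{j=1}^k\nu_j\delta_{x_j}$. $W_1$: 1-Wasserstein distance. $F_\mu$: c.d.f. of $\mu$, $F_\mu^{[-1]}(t)=\inf\{x:F_\mu(x)\ge t\}$. Standing assumptions on $\mu$: absolutely continuous with density $\rho_\mu$; support an interval on whose interior $\rho_\mu>0$; $\rho_\mu$ differentiable on the support. *)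

theory Defs
  imports "HOL-Probability.Probability" "HOL-Library.Landau_Symbols"
begin

(* Reports x_1..x_n are x 0 .. x (n-1); facilities y_1..y_k are y 1 .. y k. *)
definition SC :: "nat \<Rightarrow> nat \<Rightarrow> (nat \<Rightarrow> real) \<Rightarrow> (nat \<Rightarrow> real) \<Rightarrow> real" where
  "SC n k x y = (1 / real n) * (\<Sum>i<n. Min ((\<lambda>j. \<bar>x i - y j\<bar>) ` {1..k}))"

definition SC_opt :: "nat \<Rightarrow> nat \<Rightarrow> (nat \<Rightarrow> real) \<Rightarrow> real" where
  "SC_opt n k x = Inf {SC n k x y | y. True}"

definition percentile_vector :: "nat \<Rightarrow> (nat \<Rightarrow> real) \<Rightarrow> bool" where
  "percentile_vector k v \<longleftrightarrow>
     (\<forall>j\<in>{1..k}. 0 \<le> v j \<and> v j \<le> 1) \<and> (\<forall>i j. 1 \<le> i \<longrightarrow> i \<le> j \<longrightarrow> j \<le> k \<longrightarrow> v i \<le> v j)"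

(* output of the percentile mechanism: facility j at x_(floor((n-1) v_j)+1) (1-based order statistic) *)
definition PM :: "nat \<Rightarrow> (nat \<Rightarrow> real) \<Rightarrow> (nat \<Rightarrow> real) \<Rightarrow> nat \<Rightarrow> real" where
  "PM n v x j = sort (map x [0..<n]) ! nat \<lfloor>real (n - 1) * v j\<rfloor>"

definition SC_v :: "nat \<Rightarrow> nat \<Rightarrow> (nat \<Rightarrow> real) \<Rightarrow> (nat \<Rightarrow> real) \<Rightarrow> real" where
  "SC_v n k v x = SC n k x (PM n v x)"

definition E_SC_v :: "real measure \<Rightarrow> nat \<Rightarrow> nat \<Rightarrow> (nat \<Rightarrow> real) \<Rightarrow> real" where
  "E_SC_v \<mu> n k v = (\<integral>x. SC_v n k v x \<partial>(PiM {..<n} (\<lambda>_. \<mu>)))"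

definition E_SC_opt :: "real measure \<Rightarrow> nat \<Rightarrow> nat \<Rightarrow> real" where
  "E_SC_opt \<mu> n k = (\<integral>x. SC_opt n k x \<partial>(PiM {..<n} (\<lambda>_. \<mu>)))"

definition bayes_ar_PM :: "real measure \<Rightarrow> nat \<Rightarrow> nat \<Rightarrow> (nat \<Rightarrow> real) \<Rightarrow> real" where
  "bayes_ar_PM \<mu> n k v = E_SC_v \<mu> n k v / E_SC_opt \<mu> n k"

definition W1 :: "real measure \<Rightarrow> real measure \<Rightarrow> ennreal" where
  "W1 \<mu> \<nu> = Inf {(\<integral>\<^sup>+ p. ennreal \<bar>fst p - snd p\<bar> \<partial>\<pi>) | \<pi>.
        prob_space \<pi> \<and> sets \<pi> = sets (borel \<Otimes>\<^sub>M borel) \<and>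
        distr \<pi> borel fst = \<mu> \<and> distr \<pi> borel snd = \<nu>}"

definition discrete_measure :: "nat \<Rightarrow> (nat \<Rightarrow> real) \<Rightarrow> (nat \<Rightarrow> real) \<Rightarrow> real measure" where
  "discrete_measure k w x =
     measure_of UNIV (sets borel) (\<lambda>A. \<Sum>j\<in>{1..k}. ennreal (w j) * indicator A (x j))"

definition Pk :: "nat \<Rightarrow> real measure set" where
  "Pk k = {discrete_measure k w x | w x. (\<forall>j\<in>{1..k}. 0 \<le> w j) \<and> (\<Sum>j\<in>{1..k}. w j) = 1}"

definition quantile :: "real measure \<Rightarrow> real \<Rightarrow> real" where
  "quantile \<mu> t = Inf {x. cdf \<mu> x \<ge> t}"

(* F_mu(z_i), with z_0 = inf I, z_k = sup I, so F(z_0) = 0, F(z_k) = 1 *)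
definition F_z :: "real measure \<Rightarrow> nat \<Rightarrow> (nat \<Rightarrow> real) \<Rightarrow> nat \<Rightarrow> real" where
  "F_z \<mu> k v i = (if i = 0 then 0 else if i \<ge> k then 1
      else cdf \<mu> ((quantile \<mu> (v i) + quantile \<mu> (v (Suc i))) / 2))"

definition nu_Q :: "real measure \<Rightarrow> nat \<Rightarrow> (nat \<Rightarrow> real) \<Rightarrow> real measure" where
  "nu_Q \<mu> k v = discrete_measure k (\<lambda>i. F_z \<mu> k v i - F_z \<mu> k v (i - 1)) (\<lambda>i. quantile \<mu> (v i))"

(* the limit ratio W1(mu, nu_Q) / W1(mu, nu^(k)), with W1(mu,nu^(k)) = min over P_k *)
definition limit_ratio :: "real measure \<Rightarrow> nat \<Rightarrow> (nat \<Rightarrow> real) \<Rightarrow> real" where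
  "limit_ratio \<mu> k v = enn2real (W1 \<mu> (nu_Q \<mu> k v)) / enn2real (INF \<nu>\<in>Pk k. W1 \<mu> \<nu>)"

end

theory Submission
  imports Defs
begin

text \<open>Write \<open>f\<^sub>y\<close> for the distance to the nearest of the points \<open>y 1, \<dots>, y k\<close>. Sending every point to
  its nearest facility is an optimal coupling, so \<open>W1(\<mu>, \<nu>\<^sub>Q) = \<integral> f\<^sub>q d\<mu>\<close> with \<open>q\<close> the vector of
  quantiles, and the minimum of \<open>W1(\<mu>, \<cdot>)\<close> over \<open>P\<^sub>k\<close> is \<open>B = inf\<^sub>y \<integral> f\<^sub>y d\<mu> > 0\<close>.

  Optimal cost: since \<open>f\<^sub>y\<close> is 1-Lipschitz, integration by parts bounds \<open>\<bar>SC(x, y) - \<integral> f\<^sub>y d\<mu>\<bar>\<close> by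
  \<open>\<integral> \<bar>F\<^sub>n - F\<bar> dt\<close> uniformly in \<open>y\<close>. Its expectation is at most \<open>n powr (-1/2) * \<integral> sqrt (F (1 - F)) dt\<close>,
  which is finite by Markov's inequality for the moment of order \<open>2 + \<delta>\<close>.

  Mechanism: \<open>SC\<close> is 1-Lipschitz in the facilities, so it suffices to bound \<open>E \<bar>X\<^sub>(\<^sub>m\<^sub>) - q\<bar>\<close> for the order
  statistics. This is the integral over \<open>t\<close> of the probability that \<open>t\<close> separates \<open>X\<^sub>(\<^sub>m\<^sub>)\<close> from \<open>q\<close>,
  which Chebyshev's inequality bounds by \<open>4 F (1 - F) / (n (F - F(q))\<^sup>2)\<close>; here \<open>F - F(q)\<close> grows linearly
  near \<open>q\<close> because the density is positive there, and far away \<open>\<integral> F (1 - F) dt < \<infinity>\<close> suffices.\<close>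

section \<open>Distance to the nearest facility\<close>

definition mindist :: "nat \<Rightarrow> (nat \<Rightarrow> real) \<Rightarrow> real \<Rightarrow> real" where
  "mindist k y x = Min ((\<lambda>j. \<bar>x - y j\<bar>) ` {1..k})"

text \<open>Ties go to the smallest index. A choice by \<open>LEAST\<close> is explicit and hence
  Borel measurable, as the coupling of \<open>x\<close> with \<open>y (nearest k y x)\<close>
  requires.\<close>

definition nearest :: "nat \<Rightarrow> (nat \<Rightarrow> real) \<Rightarrow> real \<Rightarrow> nat" where
  "nearest k y x = (LEAST j. 1 \<le> j \<and> j \<le> k \<and> \<bar>x - y j\<bar> = mindist k y x)"

lemma SC_eq_mindist: "SC n k x y = (\<Sum>i<n. mindist k y (x i)) / real n"
  by (simp add: SC_def mindist_def)

lemma mindist_le: "j \<in> {1..k} \<Longrightarrow> mindist k y x \<le> \<bar>x - y j\<bar>"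
  unfolding mindist_def by (rule Min_le) auto

lemma mindist_attained:
  assumes "1 \<le> k" obtains j where "j \<in> {1..k}" "mindist k y x = \<bar>x - y j\<bar>"
proof -
  have "mindist k y x \<in> (\<lambda>j. \<bar>x - y j\<bar>) ` {1..k}"
    unfolding mindist_def using assms by (intro Min_in) auto
  then show ?thesis using that by auto
qed

lemma nearest:
  assumes "1 \<le> k"
  shows "nearest k y x \<in> {1..k}" and "\<bar>x - y (nearest k y x)\<bar> = mindist k y x"
proof -
  obtain j where "j \<in> {1..k}" "mindist k y x = \<bar>x - y j\<bar>"
    using mindist_attained[OF assms] .
  then have "1 \<le> j \<and> j \<le> k \<and> \<bar>x - y j\<bar> = mindist k y x" by auto
  then have "1 \<le> nearest k y x \<and> nearest k y x \<le> k \<and> \<bar>x - y (nearest k y x)\<bar> = mindist k y x"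
    unfolding nearest_def by (rule LeastI)
  then show "nearest k y x \<in> {1..k}" "\<bar>x - y (nearest k y x)\<bar> = mindist k y x" by auto
qed

lemma mindist_greatest:
  assumes "1 \<le> k" "\<And>j. j \<in> {1..k} \<Longrightarrow> c \<le> \<bar>x - y j\<bar>" shows "c \<le> mindist k y x"
  using nearest(1)[OF assms(1), of y x] nearest(2)[OF assms(1), of x y] assms(2) by force

lemma mindist_nonneg: "1 \<le> k \<Longrightarrow> 0 \<le> mindist k y x"
  by (rule mindist_greatest) auto

lemma mindist_perturb:
  assumes "1 \<le> k" "\<And>j. j \<in> {1..k} \<Longrightarrow> \<bar>y j - y' j\<bar> \<le> d"
  shows "mindist k y x \<le> mindist k y' x + d"
proof -
  have "mindist k y x \<le> \<bar>x - y (nearest k y' x)\<bar>"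
    using nearest(1)[OF assms(1)] by (rule mindist_le)
  also have "\<dots> \<le> \<bar>x - y' (nearest k y' x)\<bar> + d"
    using assms(2)[OF nearest(1)[OF assms(1), of y' x]] by linarith
  finally show ?thesis using nearest(2)[OF assms(1)] by simp
qed

lemma mindist_shift:
  assumes "1 \<le> k" shows "mindist k y x \<le> mindist k y x' + \<bar>x - x'\<bar>"
proof -
  have "mindist k y x \<le> \<bar>x - y (nearest k y x')\<bar>"
    using nearest(1)[OF assms(1)] by (rule mindist_le)
  also have "\<dots> \<le> \<bar>x' - y (nearest k y x')\<bar> + \<bar>x - x'\<bar>" by linarith
  finally show ?thesis using nearest(2)[OF assms(1)] by simp
qed

lemma continuous_on_mindist: "1 \<le> k \<Longrightarrow> continuous_on S (mindist k y)"
  using mindist_shift[of k y]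
  by (intro lipschitz_on_continuous_on[of 1] lipschitz_onI)
     (auto simp: dist_real_def abs_le_iff algebra_simps, metis abs_minus_commute)

lemma borel_measurable_mindist [measurable]: "1 \<le> k \<Longrightarrow> mindist k y \<in> borel_measurable borel"
  by (intro borel_measurable_continuous_onI continuous_on_mindist)

lemma measurable_nearest [measurable]:
  assumes [measurable]: "1 \<le> k" shows "nearest k y \<in> borel \<rightarrow>\<^sub>M count_space UNIV"
  unfolding nearest_def by measurable

text \<open>The derivative of \<open>mindist k y\<close> off a finite set, in a form that is defined
  and measurable everywhere.\<close>

definition mindist_slope :: "nat \<Rightarrow> (nat \<Rightarrow> real) \<Rightarrow> real \<Rightarrow> real" where
  "mindist_slope k y x = sgn (x - y (nearest k y x))"

lemma borel_measurable_mindist_slope [measurable]: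
  assumes [measurable]: "1 \<le> k" shows "mindist_slope k y \<in> borel_measurable borel"
proof -
  have "(\<lambda>x. y (nearest k y x)) \<in> borel_measurable borel"
    by (rule measurable_compose[OF measurable_nearest[OF assms]]) simp
  then show ?thesis unfolding mindist_slope_def by measurable
qed

lemma mindist_slope_le_1: "\<bar>mindist_slope k y x\<bar> \<le> 1"
  by (simp add: mindist_slope_def sgn_if)

text \<open>Away from the points \<open>y j\<close> and their midpoints the nearest point is unique, so \<open>mindist\<close>
  coincides locally with the distance to it.\<close>

lemma mindist_has_slope:
  assumes k: "1 \<le> k" and x: "x \<notin> (\<lambda>(i, j). (y i + y j) / 2) ` ({1..k} \<times> {1..k})"
  shows "(mindist k y has_real_derivative mindist_slope k y x) (at x)"
proof -
  define J where "J = nearest k y x"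
  have J: "J \<in> {1..k}" "\<bar>x - y J\<bar> = mindist k y x"
    using nearest[OF k] by (auto simp: J_def)
  have mid: "x \<noteq> (y i + y j) / 2" if "i \<in> {1..k}" "j \<in> {1..k}" for i j
    using x that by force
  \<comment> \<open>The pair \<open>(J, J)\<close> has midpoint \<open>y J\<close>, so the
    facilities themselves are among the excluded points.\<close>
  have xJ: "x \<noteq> y J" using mid[OF J(1) J(1)] by auto
  have "\<forall>\<^sub>F t in nhds x. \<bar>t - y J\<bar> \<le> \<bar>t - y j\<bar>" if j: "j \<in> {1..k}" for j
  proof (cases "y j = y J")
    case False
    \<comment> \<open>A point equidistant from two distinct facilities is their midpoint.\<close>
    have "\<bar>x - y J\<bar> \<noteq> \<bar>x - y j\<bar>" using mid[OF J(1) j] False by (auto simp: abs_if split: if_splits)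
    then have less: "\<bar>x - y J\<bar> < \<bar>x - y j\<bar>" using mindist_le[OF j, of y x] J(2) by linarith
    have "((\<lambda>t. \<bar>t - y j\<bar> - \<bar>t - y J\<bar>) \<longlongrightarrow> \<bar>x - y j\<bar> - \<bar>x - y J\<bar>) (nhds x)"
      by (intro tendsto_intros filterlim_ident)
    then have "\<forall>\<^sub>F t in nhds x. 0 < \<bar>t - y j\<bar> - \<bar>t - y J\<bar>"
      by (rule order_tendstoD) (use less in simp)
    then show ?thesis by eventually_elim simp
  qed simp
  then have "\<forall>\<^sub>F t in nhds x. \<forall>j\<in>{1..k}. \<bar>t - y J\<bar> \<le> \<bar>t - y j\<bar>"
    by (intro eventually_ball_finite) auto
  then have ev: "\<forall>\<^sub>F t in nhds x. \<bar>t - y J\<bar> = mindist k y t"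
  proof eventually_elim
    case (elim t)
    show ?case
      by (intro antisym mindist_greatest[OF k] mindist_le[OF J(1)]) (use elim in auto)
  qed
  have "((\<lambda>t. t - y J) \<longlongrightarrow> x - y J) (nhds x)"
    by (intro tendsto_intros filterlim_ident)
  then have "\<forall>\<^sub>F t in nhds x. 0 < x - y J \<longrightarrow> 0 < t - y J"
    "\<forall>\<^sub>F t in nhds x. x - y J < 0 \<longrightarrow> t - y J < 0"
    using order_tendstoD[of "\<lambda>t. t - y J" "x - y J" "nhds x" 0]
    by (cases "x > y J"; cases "x < y J"; auto)+
  then have "\<forall>\<^sub>F t in nhds x. sgn (t - y J) = sgn (x - y J)"
    by eventually_elim (use xJ in \<open>auto simp: sgn_if\<close>)
  with ev have ev': "\<forall>\<^sub>F t in nhds x. sgn (x - y J) * (t - y J) = mindist k y t"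
    by eventually_elim (metis abs_sgn mult.commute)
  have "((\<lambda>t. sgn (x - y J) * (t - y J)) has_real_derivative sgn (x - y J)) (at x)"
    by (auto intro!: derivative_eq_intros)
  then have "((\<lambda>t. mindist k y t) has_real_derivative sgn (x - y J)) (at x)"
    using DERIV_cong_ev[OF refl ev' refl] by simp
  then show ?thesis by (simp add: mindist_slope_def J_def)
qed

text \<open>The fundamental theorem of calculus tolerates a finite set of kinks, since
  \<open>mindist k y\<close> is continuous across them.\<close>

lemma mindist_diff_eq_integral:
  assumes k: "1 \<le> k" and ab: "a \<le> b"
  shows "set_integrable lborel {a..b} (mindist_slope k y)"
    and "mindist k y b - mindist k y a = (LINT t:{a..b}|lborel. mindist_slope k y t)"
proof -
  have [measurable]: "mindist_slope k y \<in> borel_measurable borel"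
    using k by (rule borel_measurable_mindist_slope)
  show *: "set_integrable lborel {a..b} (mindist_slope k y)"
    unfolding set_integrable_def
    by (rule integrableI_bounded_set_indicator[where B=1])
       (auto simp: mindist_slope_le_1 emeasure_lborel_Icc_eq)
  have "(mindist_slope k y has_integral mindist k y b - mindist k y a) {a..b}"
    by (rule fundamental_theorem_of_calculus_interior_strong
          [where S = "(\<lambda>(i, j). (y i + y j) / 2) ` ({1..k} \<times> {1..k})"])
       (auto simp: ab continuous_on_mindist[OF k] has_real_derivative_iff_has_vector_derivative[symmetric]
          intro!: mindist_has_slope[OF k])
  with set_borel_integral_eq_integral(2)[OF *]
  show "mindist k y b - mindist k y a = (LINT t:{a..b}|lborel. mindist_slope k y t)"
    by (simp add: integral_unique)
qed

text \<open>Up to null sets, integrating \<open>g\<close> against \<open>signed_ind x\<close> is the oriented integral of \<open>g\<close>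
  from \<open>0\<close> to \<open>x\<close>.\<close>

definition signed_ind :: "real \<Rightarrow> real \<Rightarrow> real" where
  "signed_ind x t = indicator {0..} t - indicator {x..} t"

lemma borel_measurable_signed_ind [measurable]:
  "(\<lambda>(x, t). signed_ind x t) \<in> borel_measurable (borel \<Otimes>\<^sub>M borel)"
proof -
  have "(\<lambda>(x, t). signed_ind x t) = (\<lambda>p. (if 0 \<le> snd p then 1 else 0) - (if fst p \<le> snd p then 1 else 0))"
    by (auto simp: signed_ind_def fun_eq_iff)
  then show ?thesis by simp
qed

lemma integrable_slope_signed_ind:
  assumes k: "1 \<le> k"
  shows "integrable lborel (\<lambda>t. mindist_slope k y t * signed_ind x t)"
    and "mindist k y x - mindist k y 0 = (\<integral>t. mindist_slope k y t * signed_ind x t \<partial>lborel)"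
proof -
  have [measurable]: "mindist_slope k y \<in> borel_measurable borel"
    using k by (rule borel_measurable_mindist_slope)
  have *: "integrable lborel (\<lambda>t. mindist_slope k y t * signed_ind x t) \<and>
    mindist k y x - mindist k y 0 = (\<integral>t. mindist_slope k y t * signed_ind x t \<partial>lborel)"
  proof (cases "0 \<le> x")
    case True
    \<comment> \<open>\<open>signed_ind x\<close> is the indicator of \<open>{0..<x}\<close> and
      differs from that of \<open>{0..x}\<close> only at \<open>x\<close>. For negative
      \<open>x\<close> it is minus the indicator of \<open>{x..<0}\<close>, and the exceptional
      point is \<open>0\<close>.\<close>
    have ae: "AE t in lborel. indicator {0..x} t *\<^sub>R mindist_slope k y t = mindist_slope k y t * signed_ind x t"
      using AE_lborel_singleton[of x]
      by eventually_elim (use True in \<open>auto simp: signed_ind_def indicator_def\<close>)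
    have m: "(\<lambda>t. mindist_slope k y t * signed_ind x t) \<in> borel_measurable lborel"
      unfolding signed_ind_def by measurable
    show ?thesis
      using mindist_diff_eq_integral[OF k True, of y] 
      unfolding set_integrable_def set_lebesgue_integral_def
      using integral_cong_AE[OF _ m ae] integrable_cong_AE[OF _ m ae] by auto
  next
    case False
    then have x0: "x \<le> 0" by simp
    have ae: "AE t in lborel. - (indicator {x..0} t *\<^sub>R mindist_slope k y t) = mindist_slope k y t * signed_ind x t"
      using AE_lborel_singleton[of 0]
      by eventually_elim (use False in \<open>auto simp: signed_ind_def indicator_def\<close>)
    have m: "(\<lambda>t. mindist_slope k y t * signed_ind x t) \<in> borel_measurable lborel"
      unfolding signed_ind_def by measurable
    have m': "(\<lambda>t. - (indicator {x..0} t *\<^sub>R mindist_slope k y t)) \<in> borel_measurable lborel"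
      by measurable
    show ?thesis
      using mindist_diff_eq_integral[OF k x0, of y] 
        integral_cong_AE[OF m' m ae] integrable_cong_AE[OF m' m ae]
      unfolding set_integrable_def set_lebesgue_integral_def by auto
  qed
  show "integrable lborel (\<lambda>t. mindist_slope k y t * signed_ind x t)"
    "mindist k y x - mindist k y 0 = (\<integral>t. mindist_slope k y t * signed_ind x t \<partial>lborel)"
    using * by auto
qed

lemma nn_integral_abs_signed_ind: "(\<integral>\<^sup>+t. ennreal \<bar>signed_ind x t\<bar> \<partial>lborel) = ennreal \<bar>x\<bar>"
proof -
  have "(\<integral>\<^sup>+t. ennreal \<bar>signed_ind x t\<bar> \<partial>lborel) = (\<integral>\<^sup>+t. indicator {min 0 x..<max 0 x} t \<partial>lborel)"
    by (intro nn_integral_cong) (auto simp: signed_ind_def indicator_def)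
  also have "\<dots> = ennreal \<bar>x\<bar>"
    by (simp add: max_def min_def)
  finally show ?thesis .
qed

section \<open>Empirical distribution functions\<close>

definition ecdf :: "nat \<Rightarrow> (nat \<Rightarrow> real) \<Rightarrow> real \<Rightarrow> real" where
  "ecdf n x t = (\<Sum>i<n. indicator {..t} (x i)) / real n"

text \<open>Integration by parts against the empirical measure:
  \<open>integrable_slope_signed_ind\<close> averaged over the sample. Apart from the constant
  \<open>mindist k y 0\<close>, the facilities enter only through a factor bounded by 1.\<close>

lemma SC_eq_integral:
  assumes k: "1 \<le> k" and n: "0 < n"
  shows "integrable lborel (\<lambda>t. mindist_slope k y t * (indicator {0..} t - ecdf n x t))"
    and "SC n k x y - mindist k y 0
      = (\<integral>t. mindist_slope k y t * (indicator {0..} t - ecdf n x t) \<partial>lborel)"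
proof -
  have eq: "mindist_slope k y t * (indicator {0..} t - ecdf n x t)
    = (\<Sum>i<n. mindist_slope k y t * signed_ind (x i) t) / real n" for t
  proof -
    \<comment> \<open>\<open>indicator {x i..} t\<close> equals
      \<open>indicator {..t} (x i)\<close>, so the subtracted sum counts the sample points up to
      \<open>t\<close>.\<close>
    have "(\<Sum>i<n. signed_ind (x i) t) = real n * (indicator {0..} t - ecdf n x t)"
      using n by (simp add: signed_ind_def ecdf_def sum_subtractf field_simps indicator_def)
    then show ?thesis using n by (simp add: sum_distrib_left[symmetric])
  qed
  note I = integrable_slope_signed_ind[OF k]
  show "integrable lborel (\<lambda>t. mindist_slope k y t * (indicator {0..} t - ecdf n x t))"
    unfolding eq using I(1) by auto
  have "SC n k x y - mindist k y 0 = (\<Sum>i<n. mindist k y (x i) - mindist k y 0) / real n"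
    using n by (simp add: SC_eq_mindist sum_subtractf field_simps)
  also have "\<dots> = (\<Sum>i<n. (\<integral>t. mindist_slope k y t * signed_ind (x i) t \<partial>lborel)) / real n"
    using I(2) by simp
  also have "\<dots> = (\<integral>t. (\<Sum>i<n. mindist_slope k y t * signed_ind (x i) t) / real n \<partial>lborel)"
    using I(1) by (simp add: Bochner_Integration.integral_sum)
  finally show "SC n k x y - mindist k y 0
      = (\<integral>t. mindist_slope k y t * (indicator {0..} t - ecdf n x t) \<partial>lborel)"
    unfolding eq .
qed

text \<open>Splitting at \<open>q\<close> leaves two equal half-line integrals. Serves both the
  moment bound (\<open>q = 0\<close>, \<open>s = 1\<close>) and the Chebyshev bound
  (\<open>a = 2\<close>, \<open>s = 1 / sqrt (real n)\<close>).\<close>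

lemma nn_integral_powr_tails:
  fixes q a s :: real
  assumes a: "1 < a" and s: "0 < s"
  shows "(\<integral>\<^sup>+t. ennreal (\<bar>t - q\<bar> powr - a) * indicator {t. s \<le> \<bar>t - q\<bar>} t \<partial>lborel)
    = ennreal (2 * (s powr (1 - a) / (a - 1)))"
proof -
  let ?I = "\<integral>\<^sup>+u. ennreal (u powr - a) * indicator {s..} u \<partial>lborel"
  have FTC: "?I = ennreal (0 - s powr (1 - a) / (1 - a))"
  proof (rule nn_integral_FTC_atLeast)
    show "DERIV (\<lambda>u. u powr (1 - a) / (1 - a)) u :> u powr - a" if "s \<le> u" for u
      using that s a by (auto intro!: derivative_eq_intros)
    have "((\<lambda>u. u powr (1 - a)) \<longlongrightarrow> 0) at_top"
      using a by (intro tendsto_neg_powr filterlim_ident) auto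
    from tendsto_divide[OF this tendsto_const, of "1 - a"] a
    show "((\<lambda>u. u powr (1 - a) / (1 - a)) \<longlongrightarrow> 0) at_top" by simp
  qed auto
  have "(\<integral>\<^sup>+t. ennreal (\<bar>t - q\<bar> powr - a) * indicator {t. s \<le> \<bar>t - q\<bar>} t \<partial>lborel)
    = (\<integral>\<^sup>+t. ennreal ((t - q) powr - a) * indicator {s..} (t - q)
        + ennreal ((q - t) powr - a) * indicator {s..} (q - t) \<partial>lborel)"
    using s by (intro nn_integral_cong) (auto simp: indicator_def)
  also have "\<dots> = (\<integral>\<^sup>+t. ennreal ((t - q) powr - a) * indicator {s..} (t - q) \<partial>lborel)
        + (\<integral>\<^sup>+t. ennreal ((q - t) powr - a) * indicator {s..} (q - t) \<partial>lborel)"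
    by (intro nn_integral_add) measurable
  also have "(\<integral>\<^sup>+t. ennreal ((t - q) powr - a) * indicator {s..} (t - q) \<partial>lborel) = ?I"
    by (subst nn_integral_real_affine[where c=1 and t=q]) auto
  also have "(\<integral>\<^sup>+t. ennreal ((q - t) powr - a) * indicator {s..} (q - t) \<partial>lborel) = ?I"
    by (subst nn_integral_real_affine[where c="-1" and t=q]) auto
  also have "?I + ?I = ennreal (2 * (s powr (1 - a) / (a - 1)))"
  proof -
    have "0 - s powr (1 - a) / (1 - a) = s powr (1 - a) / (a - 1)"
      using minus_divide_right[of "s powr (1 - a)" "a - 1"] by simp
    moreover have "0 \<le> s powr (1 - a) / (a - 1)" using a by simp
    ultimately show ?thesis unfolding FTC by (simp flip: ennreal_plus)
  qed
  finally show ?thesis .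
qed

context real_distribution
begin

lemma integrable_mindist:
  assumes k: "1 \<le> k" and m1: "integrable M (\<lambda>x. \<bar>x\<bar>)"
  shows "integrable M (mindist k y)"
proof (rule Bochner_Integration.integrable_bound)
  show "integrable M (\<lambda>x. mindist k y 0 + \<bar>x\<bar>)" using m1 by simp
  show "AE x in M. norm (mindist k y x) \<le> norm (mindist k y 0 + \<bar>x\<bar>)"
    using mindist_shift[OF k, of y _ 0] mindist_nonneg[OF k, of y] by (auto intro!: AE_I2)
qed (use k in simp)

text \<open>The counterpart of \<open>SC_eq_integral\<close> for the law itself. Fubini applies
  because \<open>nn_integral_abs_signed_ind\<close> bounds the absolute double integral by the first
  absolute moment.\<close>

lemma expectation_mindist_eq_integral:
  assumes k: "1 \<le> k" and m1: "integrable M (\<lambda>x. \<bar>x\<bar>)"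
  shows "integrable lborel (\<lambda>t. mindist_slope k y t * (indicator {0..} t - cdf M t))"
    and "(\<integral>x. mindist k y x \<partial>M) - mindist k y 0
      = (\<integral>t. mindist_slope k y t * (indicator {0..} t - cdf M t) \<partial>lborel)"
proof -
  interpret P: pair_sigma_finite M lborel ..
  have [measurable]: "mindist_slope k y \<in> borel_measurable borel"
    using k by (rule borel_measurable_mindist_slope)
  let ?f = "\<lambda>x t. mindist_slope k y t * signed_ind x t"
  have meas: "(\<lambda>(x, t). ?f x t) \<in> borel_measurable (M \<Otimes>\<^sub>M lborel)"
    using borel_measurable_signed_ind by measurable
  have int: "integrable (M \<Otimes>\<^sub>M lborel) (\<lambda>(x, t). ?f x t)"
  proof (rule integrableI_bounded[OF meas])
    have "(\<integral>\<^sup>+p. ennreal (norm (case p of (x, t) \<Rightarrow> ?f x t)) \<partial>(M \<Otimes>\<^sub>M lborel))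
      = (\<integral>\<^sup>+x. \<integral>\<^sup>+t. ennreal (norm (?f x t)) \<partial>lborel \<partial>M)"
      using meas by (subst lborel.nn_integral_fst[symmetric]) auto
    also have "\<dots> \<le> (\<integral>\<^sup>+x. \<integral>\<^sup>+t. ennreal \<bar>signed_ind x t\<bar> \<partial>lborel \<partial>M)"
      by (intro nn_integral_mono ennreal_leI)
         (auto simp: abs_mult intro!: mult_left_le_one_le mindist_slope_le_1)
    also have "\<dots> = (\<integral>\<^sup>+x. ennreal \<bar>x\<bar> \<partial>M)" by (simp add: nn_integral_abs_signed_ind)
    also have "\<dots> < \<infinity>" using m1 by (simp add: integrable_iff_bounded)
    finally show "(\<integral>\<^sup>+p. ennreal (norm (case p of (x, t) \<Rightarrow> ?f x t)) \<partial>(M \<Otimes>\<^sub>M lborel)) < \<infinity>" .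
  qed
  have inner: "(\<integral>x. ?f x t \<partial>M) = mindist_slope k y t * (indicator {0..} t - cdf M t)" for t
  proof -
    have "(\<integral>x. signed_ind x t \<partial>M) = (\<integral>x. indicator {0..} t - indicator {..t} x \<partial>M)"
      by (intro Bochner_Integration.integral_cong) (auto simp: signed_ind_def indicator_def)
    also have "\<dots> = indicator {0..} t - cdf M t"
      by (subst Bochner_Integration.integral_diff)
         (auto simp: cdf_def prob_space[unfolded space_eq_univ] emeasure_eq_measure)
    finally show ?thesis by simp
  qed
  show "integrable lborel (\<lambda>t. mindist_slope k y t * (indicator {0..} t - cdf M t))"
    using P.integrable_snd[OF int] unfolding inner .
  have "(\<integral>x. mindist k y x \<partial>M) - mindist k y 0 = (\<integral>x. mindist k y x - mindist k y 0 \<partial>M)"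
    using integrable_mindist[OF k m1, of y]
    by (simp add: prob_space[unfolded space_eq_univ])
  also have "\<dots> = (\<integral>x. \<integral>t. ?f x t \<partial>lborel \<partial>M)"
    by (simp add: integrable_slope_signed_ind(2)[OF k])
  also have "\<dots> = (\<integral>t. \<integral>x. ?f x t \<partial>M \<partial>lborel)"
    using P.Fubini_integral[OF int] by simp
  finally show "(\<integral>x. mindist k y x \<partial>M) - mindist k y 0
      = (\<integral>t. mindist_slope k y t * (indicator {0..} t - cdf M t) \<partial>lborel)"
    unfolding inner .
qed

text \<open>In the difference of the two integral representations only
  \<open>ecdf n x t - cdf M t\<close> times the slope survives. The error term is free of
  \<open>y\<close>, so an infimum over \<open>y\<close> can be taken later; in
  \<open>ennreal\<close> it may be infinite.\<close>

lemma expectation_mindist_le_SC: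
  assumes k: "1 \<le> k" and n: "0 < n" and m1: "integrable M (\<lambda>x. \<bar>x\<bar>)"
  shows "ennreal (\<integral>x. mindist k y x \<partial>M)
    \<le> ennreal (SC n k x y) + (\<integral>\<^sup>+t. ennreal \<bar>ecdf n x t - cdf M t\<bar> \<partial>lborel)"
proof -
  note E = expectation_mindist_eq_integral[OF k m1, of y] and S = SC_eq_integral(1)[OF k n, of y x] SC_eq_integral(2)[OF k n, of x y]
  let ?h = "\<lambda>t. mindist_slope k y t * (ecdf n x t - cdf M t)"
  have h: "?h = (\<lambda>t. mindist_slope k y t * (indicator {0..} t - cdf M t) -
    mindist_slope k y t * (indicator {0..} t - ecdf n x t))"
    by (auto simp: algebra_simps)
  have int: "integrable lborel ?h" unfolding h using E(1) S(1) by simp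
  have eq: "(\<integral>x. mindist k y x \<partial>M) = SC n k x y + (\<integral>t. ?h t \<partial>lborel)"
    unfolding h using E S by simp
  have "SC n k x y \<ge> 0"
    using mindist_nonneg[OF k] by (simp add: SC_eq_mindist sum_nonneg)
  then have "ennreal (\<integral>x. mindist k y x \<partial>M) \<le> ennreal (SC n k x y) + ennreal \<bar>\<integral>t. ?h t \<partial>lborel\<bar>"
    unfolding eq by (simp flip: ennreal_plus add: ennreal_leI)
  also have "ennreal \<bar>\<integral>t. ?h t \<partial>lborel\<bar> \<le> (\<integral>\<^sup>+t. ennreal (norm (?h t)) \<partial>lborel)"
    using integral_norm_bound_ennreal[OF int] by simp
  also have "\<dots> \<le> (\<integral>\<^sup>+t. ennreal \<bar>ecdf n x t - cdf M t\<bar> \<partial>lborel)"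
    by (intro nn_integral_mono ennreal_leI)
       (auto simp: abs_mult intro!: mult_left_le_one_le mindist_slope_le_1)
  finally show ?thesis by (simp add: add_left_mono)
qed

section \<open>I.i.d. samples and the mean deviation of the empirical distribution function\<close>

abbreviation sample :: "nat \<Rightarrow> (nat \<Rightarrow> real) measure" where
  "sample n \<equiv> PiM {..<n} (\<lambda>_. M)"

lemma prob_space_sample: "prob_space (sample n)"
  by (intro prob_space_PiM prob_space_axioms)

lemma borel_measurable_sample_component [measurable (raw)]:
  "i < n \<Longrightarrow> (\<lambda>x. x i) \<in> borel_measurable (sample n)"
  using measurable_component_singleton[of i "{..<n}" "\<lambda>_. M"] by simp

lemma borel_measurable_ecdf [measurable]: "(\<lambda>x. ecdf n x t) \<in> borel_measurable (sample n)"
proof -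
  have "(\<lambda>x. indicator {..t} (x i) :: real) \<in> borel_measurable (sample n)" if "i < n" for i
    using that by measurable
  then show ?thesis unfolding ecdf_def by (intro borel_measurable_divide borel_measurable_sum) auto
qed

lemma borel_measurable_cdf [measurable]: "cdf M \<in> borel_measurable borel"
  using cdf_nondecreasing by (intro borel_measurable_mono monoI) auto

lemma borel_measurable_ecdf_pair [measurable]:
  "(\<lambda>(x, t). ecdf n x t) \<in> borel_measurable (sample n \<Otimes>\<^sub>M lborel)"
proof -
  have "(\<lambda>p. indicator {..snd p} (fst p i) :: real) \<in> borel_measurable (sample n \<Otimes>\<^sub>M lborel)"
    if i: "i < n" for i
  proof -
    have [measurable]: "(\<lambda>p. fst p i) \<in> borel_measurable (sample n \<Otimes>\<^sub>M lborel)"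
      by (rule measurable_compose[OF measurable_fst borel_measurable_sample_component[OF i]])
    have eq: "(\<lambda>p. indicator {..snd p} (fst p i) :: real) = (\<lambda>p. if fst p i \<le> snd p then 1 else 0)"
      by (auto simp: indicator_def)
    show ?thesis unfolding eq by measurable
  qed
  then show ?thesis
    unfolding ecdf_def split_beta by (intro borel_measurable_divide borel_measurable_sum) auto
qed

text \<open>Independence factorizes the expectation, and centring of \<open>\<phi>\<close> kills the
  off-diagonal covariances.\<close>

lemma integral_prod_two_sample:
  fixes \<phi> :: "real \<Rightarrow> real"
  assumes [measurable]: "\<phi> \<in> borel_measurable borel" and bd: "\<And>z. \<bar>\<phi> z\<bar> \<le> 1"
    and mean: "(\<integral>z. \<phi> z \<partial>M) = 0" and ij: "i < n" "j < n"
  shows "integrable (sample n) (\<lambda>x. \<phi> (x i) * \<phi> (x j))"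
    and "(\<integral>x. \<phi> (x i) * \<phi> (x j) \<partial>sample n) = (if i = j then \<integral>z. (\<phi> z)\<^sup>2 \<partial>M else 0)"
proof -
  interpret S: prob_space "sample n" by (rule prob_space_sample)
  interpret product_sigma_finite "\<lambda>_::nat. M" ..
  have [measurable]: "(\<lambda>x. x i) \<in> borel_measurable (sample n)" "(\<lambda>x. x j) \<in> borel_measurable (sample n)"
    using ij by auto
  have bd2: "\<bar>\<phi> z * \<phi> w\<bar> \<le> 1" for z w
    using bd mult_mono[of "\<bar>\<phi> z\<bar>" 1 "\<bar>\<phi> w\<bar>" 1] by (simp add: abs_mult)
  show "integrable (sample n) (\<lambda>x. \<phi> (x i) * \<phi> (x j))"
    by (rule S.integrable_const_bound[where B = 1]) (auto simp: bd2)
  \<comment> \<open>Writes the product as one factor per coordinate, so that the product formula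
    covers both cases: for \<open>i = j\<close> the two conditions meet in one factor
    \<open>(\<phi> z)\<^sup>2\<close>.\<close>
  define h where "h l z = (if l = i then \<phi> z else 1) * (if l = j then \<phi> z else 1)" for l z
  have "(\<integral>x. (\<Prod>l<n. h l (x l)) \<partial>sample n) = (\<Prod>l<n. \<integral>z. h l z \<partial>M)"
  proof (rule product_integral_prod)
    show "integrable M (h l)" for l
      unfolding h_def by (rule integrable_const_bound[where B = 1]) (auto simp: bd bd2 intro!: AE_I2 abs_le_D1[OF bd2])
  qed simp
  moreover have "(\<Prod>l<n. h l (x l)) = \<phi> (x i) * \<phi> (x j)" for x
    using ij by (simp add: h_def prod.distrib)
  moreover have "(\<Prod>l<n. \<integral>z. h l z \<partial>M) = (if i = j then \<integral>z. (\<phi> z)\<^sup>2 \<partial>M else 0)"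
  proof (cases "i = j")
    case True
    have "(\<integral>z. h l z \<partial>M) = (if l = i then \<integral>z. (\<phi> z)\<^sup>2 \<partial>M else 1)" for l
      using True by (simp add: h_def power2_eq_square prob_space[unfolded space_eq_univ])
    then show ?thesis using True ij by simp
  next
    case False
    then have "(\<integral>z. h i z \<partial>M) = 0" using mean by (simp add: h_def)
    then show ?thesis using False ij by (auto intro!: prod_zero bexI[of _ i])
  qed
  ultimately show "(\<integral>x. \<phi> (x i) * \<phi> (x j) \<partial>sample n) = (if i = j then \<integral>z. (\<phi> z)\<^sup>2 \<partial>M else 0)"
    by simp
qed

text \<open>The binomial variance: after expanding the square of the sum of centred indicators, only
  the \<open>n\<close> diagonal terms remain.\<close>

lemma ecdf_variance:
  assumes n: "0 < n"
  shows "integrable (sample n) (\<lambda>x. (ecdf n x t - cdf M t)\<^sup>2)"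
    and "(\<integral>x. (ecdf n x t - cdf M t)\<^sup>2 \<partial>sample n) = cdf M t * (1 - cdf M t) / real n"
proof -
  define \<phi> where "\<phi> z = indicator {..t} z - cdf M t" for z
  have [measurable]: "\<phi> \<in> borel_measurable borel" unfolding \<phi>_def by measurable
  have bd: "\<bar>\<phi> z\<bar> \<le> 1" for z
    using cdf_bounded_prob[of t] cdf_nonneg[of t] by (auto simp: \<phi>_def indicator_def)
  have ind: "(\<integral>z. indicator {..t} z \<partial>M) = cdf M t" by (simp add: cdf_def)
  have mean: "(\<integral>z. \<phi> z \<partial>M) = 0"
    unfolding \<phi>_def by (simp add: ind prob_space[unfolded space_eq_univ] emeasure_eq_measure cdf_def)
  have "(\<phi> z)\<^sup>2 = (1 - 2 * cdf M t) * indicator {..t} z + (cdf M t)\<^sup>2" for z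
    by (auto simp: \<phi>_def indicator_def power2_eq_square algebra_simps)
  then have "(\<integral>z. (\<phi> z)\<^sup>2 \<partial>M) = (1 - 2 * cdf M t) * cdf M t + (cdf M t)\<^sup>2"
    by (simp add: ind prob_space[unfolded space_eq_univ] emeasure_eq_measure cdf_def)
  then have sq: "(\<integral>z. (\<phi> z)\<^sup>2 \<partial>M) = cdf M t * (1 - cdf M t)"
    by (simp add: power2_eq_square algebra_simps)
  note I = integral_prod_two_sample[OF \<open>\<phi> \<in> borel_measurable borel\<close> bd mean]
  have eq: "(ecdf n x t - cdf M t)\<^sup>2 = (\<Sum>i<n. \<Sum>j<n. \<phi> (x i) * \<phi> (x j)) / (real n)\<^sup>2" for x
  proof -
    have "ecdf n x t - cdf M t = (\<Sum>i<n. \<phi> (x i)) / real n"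
      using n by (simp add: ecdf_def \<phi>_def sum_subtractf field_simps)
    then show ?thesis by (simp add: power_divide power2_eq_square sum_product)
  qed
  show "integrable (sample n) (\<lambda>x. (ecdf n x t - cdf M t)\<^sup>2)"
    unfolding eq using I(1) by (auto intro!: Bochner_Integration.integrable_sum integrable_divide_zero)
  have "(\<integral>x. (ecdf n x t - cdf M t)\<^sup>2 \<partial>sample n)
    = (\<Sum>i<n. \<Sum>j<n. \<integral>x. \<phi> (x i) * \<phi> (x j) \<partial>sample n) / (real n)\<^sup>2"
  proof -
    have "(\<integral>x. (\<Sum>i<n. \<Sum>j<n. \<phi> (x i) * \<phi> (x j)) \<partial>sample n)
      = (\<Sum>i<n. \<integral>x. (\<Sum>j<n. \<phi> (x i) * \<phi> (x j)) \<partial>sample n)"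
      using I(1) by (intro Bochner_Integration.integral_sum Bochner_Integration.integrable_sum) auto
    also have "\<dots> = (\<Sum>i<n. \<Sum>j<n. \<integral>x. \<phi> (x i) * \<phi> (x j) \<partial>sample n)"
      using I(1) by (intro sum.cong refl Bochner_Integration.integral_sum) auto
    finally show ?thesis unfolding eq by simp
  qed
  also have "(\<Sum>i<n. \<Sum>j<n. \<integral>x. \<phi> (x i) * \<phi> (x j) \<partial>sample n) = (\<Sum>i<n. \<Sum>j<n. if i = j then cdf M t * (1 - cdf M t) else 0)"
    using I(2) by (intro sum.cong refl) (auto simp: sq)
  also have "\<dots> = real n * (cdf M t * (1 - cdf M t))" by simp
  finally show "(\<integral>x. (ecdf n x t - cdf M t)\<^sup>2 \<partial>sample n) = cdf M t * (1 - cdf M t) / real n"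
    using n by (simp add: power2_eq_square)
qed

lemma cdf_variance_bounds: "0 \<le> cdf M t * (1 - cdf M t)" "cdf M t * (1 - cdf M t) \<le> 1"
  using cdf_bounded_prob[of t] cdf_nonneg[of t] mult_le_one[of "cdf M t" "1 - cdf M t"] by auto

text \<open>Cauchy-Schwarz, in the form that the variance of the absolute deviation is
  nonnegative.\<close>

lemma ecdf_mean_deviation:
  assumes n: "0 < n"
  shows "(\<integral>\<^sup>+x. ennreal \<bar>ecdf n x t - cdf M t\<bar> \<partial>sample n)
    \<le> ennreal (sqrt (cdf M t * (1 - cdf M t)) / sqrt (real n))"
proof -
  interpret S: prob_space "sample n" by (rule prob_space_sample)
  let ?Z = "\<lambda>x. \<bar>ecdf n x t - cdf M t\<bar>"
  have "0 \<le> ecdf n x t \<and> ecdf n x t \<le> 1" for x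
  proof -
    have "(\<Sum>i<n. indicator {..t} (x i)) \<le> (\<Sum>i<n. 1::real)"
      by (intro sum_mono) (auto simp: indicator_def)
    then show ?thesis using n by (simp add: ecdf_def sum_nonneg)
  qed
  then have "?Z x \<le> 1" for x
    using cdf_bounded_prob[of t] cdf_nonneg[of t] by (smt (verit))
  then have int: "integrable (sample n) ?Z"
    by (intro S.integrable_const_bound[where B = 1]) auto
  have "0 \<le> S.variance ?Z" by (rule S.variance_positive)
  also have "\<dots> = (\<integral>x. (?Z x)\<^sup>2 \<partial>sample n) - (\<integral>x. ?Z x \<partial>sample n)\<^sup>2"
    using int ecdf_variance(1)[OF n] by (intro S.variance_eq) auto
  finally have "(\<integral>x. ?Z x \<partial>sample n)\<^sup>2 \<le> cdf M t * (1 - cdf M t) / real n"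
    by (simp add: ecdf_variance(2)[OF n])
  then have "(\<integral>x. ?Z x \<partial>sample n) \<le> sqrt (cdf M t * (1 - cdf M t) / real n)"
    by (rule real_le_rsqrt)
  then show ?thesis
    using int by (subst nn_integral_eq_integral) (auto simp: real_sqrt_divide ennreal_leI)
qed

lemma sample_nn_integral_ecdf_deviation:
  assumes n: "0 < n"
  shows "(\<integral>\<^sup>+x. \<integral>\<^sup>+t. ennreal \<bar>ecdf n x t - cdf M t\<bar> \<partial>lborel \<partial>sample n)
    \<le> (\<integral>\<^sup>+t. ennreal (sqrt (cdf M t * (1 - cdf M t))) \<partial>lborel) * ennreal (1 / sqrt (real n))"
proof -
  interpret S: prob_space "sample n" by (rule prob_space_sample)
  interpret P: pair_sigma_finite "sample n" lborel ..
  have "(\<integral>\<^sup>+x. \<integral>\<^sup>+t. ennreal \<bar>ecdf n x t - cdf M t\<bar> \<partial>lborel \<partial>sample n)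
    = (\<integral>\<^sup>+t. \<integral>\<^sup>+x. ennreal \<bar>ecdf n x t - cdf M t\<bar> \<partial>sample n \<partial>lborel)"
    by (rule P.Fubini'[symmetric]) measurable
  also have "\<dots> \<le> (\<integral>\<^sup>+t. ennreal (sqrt (cdf M t * (1 - cdf M t)) / sqrt (real n)) \<partial>lborel)"
    by (intro nn_integral_mono ecdf_mean_deviation[OF n])
  also have "\<dots> = (\<integral>\<^sup>+t. ennreal (sqrt (cdf M t * (1 - cdf M t))) * ennreal (1 / sqrt (real n)) \<partial>lborel)"
    by (intro nn_integral_cong) (simp flip: ennreal_mult' add: cdf_variance_bounds)
  also have "\<dots> = (\<integral>\<^sup>+t. ennreal (sqrt (cdf M t * (1 - cdf M t))) \<partial>lborel) * ennreal (1 / sqrt (real n))"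
    by (rule nn_integral_multc) measurable
  finally show ?thesis .
qed

text \<open>One of the two factors is the probability of a tail beyond \<open>t\<close>, upper or
  lower according to the sign of \<open>t\<close>; the other is at most 1. Markov's inequality
  bounds the tail.\<close>

lemma cdf_variance_le_Markov:
  assumes p: "0 < p" and int: "integrable M (\<lambda>x. \<bar>x\<bar> powr p)" and t: "t \<noteq> 0"
  shows "cdf M t * (1 - cdf M t) \<le> (\<integral>x. \<bar>x\<bar> powr p \<partial>M) * \<bar>t\<bar> powr - p"
proof -
  have "cdf M t * (1 - cdf M t) \<le> prob {x. \<bar>t\<bar> \<le> \<bar>x\<bar>}"
  proof (cases "0 < t")
    case True
    have "1 - cdf M t = prob {t<..}"
      using prob_compl[of "{..t}"] by (simp add: cdf_def Compl_eq_Diff_UNIV[symmetric] not_le)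
    also have "\<dots> \<le> prob {x. \<bar>t\<bar> \<le> \<bar>x\<bar>}" using True by (intro finite_measure_mono) auto
    finally show ?thesis
      using cdf_bounded_prob[of t] cdf_nonneg[of t] mult_left_le_one_le[of "1 - cdf M t" "cdf M t"]
      by linarith
  next
    case False
    have "cdf M t \<le> prob {x. \<bar>t\<bar> \<le> \<bar>x\<bar>}"
      using False unfolding cdf_def by (intro finite_measure_mono) auto
    then show ?thesis
      using cdf_bounded_prob[of t] cdf_nonneg[of t] mult_left_le[of "1 - cdf M t" "cdf M t"]
      by linarith
  qed
  also have "\<dots> = prob {x \<in> space M. \<bar>t\<bar> powr p \<le> \<bar>x\<bar> powr p}"
    using p powr_less_mono2[OF p, of "\<bar>_\<bar>" "\<bar>t\<bar>"]
    by (intro arg_cong[where f = prob]) (auto simp: powr_mono2, force simp: not_le[symmetric])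
  also have "\<dots> \<le> (\<integral>x. \<bar>x\<bar> powr p \<partial>M) / \<bar>t\<bar> powr p"
    using t int by (intro integral_Markov_inequality_measure[where A = "{}"]) auto
  finally show ?thesis by (simp add: powr_minus divide_inverse)
qed

text \<open>The square root halves the decay exponent \<open>2 + \<delta>\<close> to
  \<open>1 + \<delta> / 2\<close>, which still exceeds 1 and is therefore integrable at
  infinity.\<close>

lemma nn_integral_sqrt_cdf_variance_finite:
  assumes \<delta>: "0 < \<delta>" and int: "integrable M (\<lambda>x. \<bar>x\<bar> powr (2 + \<delta>))"
  shows "(\<integral>\<^sup>+t. ennreal (sqrt (cdf M t * (1 - cdf M t))) \<partial>lborel) < \<infinity>"
proof -
  define K where "K = sqrt (\<integral>x. \<bar>x\<bar> powr (2 + \<delta>) \<partial>M)"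
  have K: "0 \<le> K" by (simp add: K_def)
  have le: "ennreal (sqrt (cdf M t * (1 - cdf M t))) \<le> indicator {-1..1} t
      + ennreal K * (ennreal (\<bar>t - 0\<bar> powr - (1 + \<delta> / 2)) * indicator {t. 1 \<le> \<bar>t - 0\<bar>} t)" for t
  proof (cases "\<bar>t\<bar> < 1")
    case True
    then have "t \<in> {-1..1}" by auto
    then show ?thesis using cdf_variance_bounds[of t] by (simp add: add_increasing2)
  next
    case False
    then have "cdf M t * (1 - cdf M t) \<le> (\<integral>x. \<bar>x\<bar> powr (2 + \<delta>) \<partial>M) * \<bar>t\<bar> powr - (2 + \<delta>)"
      using \<delta> by (intro cdf_variance_le_Markov int) auto
    then have "sqrt (cdf M t * (1 - cdf M t)) \<le> K * sqrt (\<bar>t\<bar> powr - (2 + \<delta>))"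
      by (simp add: K_def flip: real_sqrt_mult)
    also have "sqrt (\<bar>t\<bar> powr - (2 + \<delta>)) = \<bar>t\<bar> powr - (1 + \<delta> / 2)"
      by (simp add: powr_half_sqrt[symmetric] powr_powr add_divide_distrib diff_divide_distrib)
    finally have "ennreal (sqrt (cdf M t * (1 - cdf M t))) \<le> ennreal K * ennreal (\<bar>t\<bar> powr - (1 + \<delta> / 2))"
      using K by (simp flip: ennreal_mult add: ennreal_leI)
    then show ?thesis using False by (simp add: add_increasing)
  qed
  have "(\<integral>\<^sup>+t. ennreal (sqrt (cdf M t * (1 - cdf M t))) \<partial>lborel)
    \<le> (\<integral>\<^sup>+t. indicator {-1..1} t
      + ennreal K * (ennreal (\<bar>t - 0\<bar> powr - (1 + \<delta> / 2)) * indicator {t. 1 \<le> \<bar>t - 0\<bar>} t) \<partial>lborel)"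
    by (intro nn_integral_mono le)
  also have "\<dots> = (\<integral>\<^sup>+t. indicator {-1..1::real} t \<partial>lborel)
      + (\<integral>\<^sup>+t. ennreal K * (ennreal (\<bar>t - 0\<bar> powr - (1 + \<delta> / 2)) * indicator {t. 1 \<le> \<bar>t - 0\<bar>} t) \<partial>lborel)"
    by (intro nn_integral_add) measurable
  also have "\<dots> = (\<integral>\<^sup>+t. indicator {-1..1::real} t \<partial>lborel)
      + ennreal K * (\<integral>\<^sup>+t. ennreal (\<bar>t - 0\<bar> powr - (1 + \<delta> / 2)) * indicator {t. 1 \<le> \<bar>t - 0\<bar>} t \<partial>lborel)"
    by (subst nn_integral_cmult) measurable
  also have "\<dots> < \<infinity>"
    using \<delta> by (subst nn_integral_powr_tails) (auto simp: ennreal_mult_less_top)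
  finally show ?thesis .
qed

end

section \<open>Order statistics\<close>

text \<open>One facility of the percentile mechanism in isolation. List positions start at 0, so the
  one-based rank loses its \<open>+ 1\<close>.\<close>

definition order_stat :: "nat \<Rightarrow> real \<Rightarrow> (nat \<Rightarrow> real) \<Rightarrow> real" where
  "order_stat n p x = sort (map x [0..<n]) ! nat \<lfloor>real (n - 1) * p\<rfloor>"

lemma PM_eq_order_stat: "PM n v x j = order_stat n (v j) x"
  by (simp add: PM_def order_stat_def)

text \<open>In a sorted list the positions with entry at most \<open>t\<close> form an initial
  segment, here of length \<open>n * ecdf n x t\<close>; position \<open>m\<close> lies in it iff
  that length exceeds \<open>m\<close>.\<close>

lemma sort_nth_le_iff:
  fixes x :: "nat \<Rightarrow> real"
  assumes m: "m < n"
  shows "sort (map x [0..<n]) ! m \<le> t \<longleftrightarrow> real m < real n * ecdf n x t"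
proof -
  define xs where "xs = sort (map x [0..<n])"
  have len: "length xs = n" and sorted: "sorted xs" by (auto simp: xs_def)
  have "real n * ecdf n x t = (\<Sum>i<n. indicator {..t} (x i))"
    using m by (simp add: ecdf_def)
  also have "\<dots> = real (length (filter (\<lambda>z. z \<le> t) (map x [0..<n])))"
  proof -
    have "length (filter (\<lambda>z. z \<le> t) (map x [0..<n])) = card {i. i < n \<and> x i \<le> t}"
      unfolding length_filter_conv_card by (intro arg_cong[where f = card]) auto
    moreover have "(\<Sum>i<n. indicator {..t} (x i) :: real) = real (card {i. i < n \<and> x i \<le> t})"
      by (simp add: indicator_def sum.If_cases Int_def)
    ultimately show ?thesis by simp
  qed
  also have "length (filter (\<lambda>z. z \<le> t) (map x [0..<n])) = length (filter (\<lambda>z. z \<le> t) xs)"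
    unfolding xs_def by (metis mset_filter mset_sort size_mset)
  also have "\<dots> = card {i. i < n \<and> xs ! i \<le> t}"
    by (simp add: length_filter_conv_card len)
  finally have count: "real n * ecdf n x t = real (card {i. i < n \<and> xs ! i \<le> t})" .
  show ?thesis
  proof (cases "xs ! m \<le> t")
    case True
    have "{..m} \<subseteq> {i. i < n \<and> xs ! i \<le> t}"
    proof safe
      fix i assume "i \<le> m"
      then show "i < n" "xs ! i \<le> t"
        using m True sorted_nth_mono[OF sorted, of i m] len by auto
    qed
    then have "card {..m} \<le> card {i. i < n \<and> xs ! i \<le> t}" by (intro card_mono) auto
    then show ?thesis using True unfolding count xs_def[symmetric] by simp
  next
    case False
    have "{i. i < n \<and> xs ! i \<le> t} \<subseteq> {..<m}"
    proof safe
      fix i assume "i < n" "xs ! i \<le> t"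
      then show "i < m"
        using False sorted_nth_mono[OF sorted, of m i] len by (cases "i < m") auto
    qed
    then have "card {i. i < n \<and> xs ! i \<le> t} \<le> card {..<m}" by (intro card_mono) auto
    then show ?thesis using False unfolding count xs_def[symmetric] by simp
  qed
qed

text \<open>The rank lies in the interval from \<open>n * p - 2\<close> to \<open>n * p\<close>.
  Since \<open>n * ecdf n x t\<close> is an integer, exceeding the rank means exceeding it by at
  least 1, which reduces the loss from \<open>2 / n\<close> to \<open>1 / n\<close>.\<close>

lemma
  assumes p: "0 < p" "p < 1" and n: "0 < n"
  shows order_stat_le_iff: "order_stat n p x \<le> t \<longleftrightarrow> real (nat \<lfloor>real (n - 1) * p\<rfloor>) < real n * ecdf n x t"
    and ecdf_ge_of_order_stat_le: "order_stat n p x \<le> t \<Longrightarrow> p - 1 / real n \<le> ecdf n x t"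
    and ecdf_le_of_less_order_stat: "t < order_stat n p x \<Longrightarrow> ecdf n x t \<le> p"
proof -
  let ?m = "nat \<lfloor>real (n - 1) * p\<rfloor>"
  have m: "real ?m \<le> real (n - 1) * p" "real (n - 1) * p < real ?m + 1"
    using p by auto
  have n1: "real (n - 1) = real n - 1" using n by (simp add: of_nat_diff)
  have "real (n - 1) * p \<le> real (n - 1)" using p by (simp add: mult_left_le)
  then have "real ?m < real n" using m(1) n1 by linarith
  then have mn: "?m < n" by (simp only: of_nat_less_iff)
  show iff: "order_stat n p x \<le> t \<longleftrightarrow> real ?m < real n * ecdf n x t"
    unfolding order_stat_def by (rule sort_nth_le_iff[OF mn])
  have "real (n - 1) * p = real n * p - p" unfolding n1 by (simp add: algebra_simps)
  then have m': "real ?m \<le> real n * p" "real n * p - 2 < real ?m" using m p by linarith+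
  show "ecdf n x t \<le> p" if "t < order_stat n p x"
  proof -
    have "real n * ecdf n x t \<le> real n * p" using that iff m'(1) by linarith
    then show ?thesis using n by simp
  qed
  show "p - 1 / real n \<le> ecdf n x t" if le: "order_stat n p x \<le> t"
  proof -
    have "(\<Sum>i<n. indicator {..t} (x i) :: real) = real (card {i. i < n \<and> x i \<le> t})"
      by (simp add: indicator_def sum.If_cases Int_def)
    then obtain c :: nat where c: "real n * ecdf n x t = real c"
      using n that[of "card {i. i < n \<and> x i \<le> t}"] by (auto simp: ecdf_def)
    have "?m < c" using le iff c by (simp only: of_nat_less_iff)
    then have "real ?m + 1 \<le> real c" by linarith
    then have "real n * p - 1 \<le> real n * ecdf n x t" using m'(2) c by linarith
    then show ?thesis using n by (simp add: field_simps)
  qed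
qed

context real_distribution
begin

text \<open>Sublevel sets are events about \<open>ecdf\<close>, so the sorting itself need not be
  shown measurable.\<close>

lemma borel_measurable_order_stat [measurable]:
  assumes p: "0 < p" "p < 1" and n: "0 < n"
  shows "order_stat n p \<in> borel_measurable (sample n)"
  unfolding borel_measurable_iff_le order_stat_le_iff[OF assms] by measurable

text \<open>If \<open>t\<close> separates \<open>q\<close> from the order statistic, then
  \<open>ecdf n x t\<close> and \<open>cdf M t\<close> lie on opposite sides of \<open>p\<close>, up
  to the rank error \<open>1 / n\<close>. The half-open interval matches the two cases
  \<open>order_stat n p x \<le> t\<close> and \<open>t < order_stat n p x\<close>.\<close>

lemma order_stat_event:
  assumes p: "0 < p" "p < 1" and n: "0 < n" and q: "cdf M q = p"
    and t: "t \<in> {min q (order_stat n p x)..<max q (order_stat n p x)}"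
  shows "\<bar>cdf M t - p\<bar> - 1 / real n \<le> \<bar>ecdf n x t - cdf M t\<bar>"
proof (cases "t < q")
  case True
  then have "order_stat n p x \<le> t" using t by (auto simp: min_def max_def split: if_splits)
  then have "p - 1 / real n \<le> ecdf n x t" by (rule ecdf_ge_of_order_stat_le[OF p n])
  moreover have "cdf M t \<le> p" using cdf_nondecreasing[of t q] True q by simp
  ultimately show ?thesis by linarith
next
  case False
  then have "t < order_stat n p x" using t by (auto simp: min_def max_def split: if_splits)
  then have "ecdf n x t \<le> p" by (rule ecdf_le_of_less_order_stat[OF p n])
  moreover have "p \<le> cdf M t" using cdf_nondecreasing[of q t] False q by simp
  ultimately show ?thesis using n by (smt (verit) divide_nonneg_nonneg of_nat_0_le_iff)
qed

text \<open>Chebyshev's inequality in pointwise form, for the event that \<open>t\<close> separates \<open>q\<close> from the order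
  statistic.\<close>

lemma order_stat_indicator_le:
  assumes p: "0 < p" "p < 1" and n: "0 < n" and q: "cdf M q = p"
    and c: "0 < c" and \<epsilon>: "0 < \<epsilon>" and growth: "\<And>t. c * min \<bar>t - q\<bar> \<epsilon> \<le> \<bar>cdf M t - p\<bar>"
    and n1: "2 / real n \<le> c / sqrt (real n)" and n2: "2 / real n \<le> c * \<epsilon>"
  shows "indicator {min q (order_stat n p x)..<max q (order_stat n p x)} t
    \<le> (if \<bar>t - q\<bar> < 1 / sqrt (real n) then 1
       else 4 / c\<^sup>2 * (\<bar>t - q\<bar> powr - 2 + 1 / \<epsilon>\<^sup>2) * (ecdf n x t - cdf M t)\<^sup>2)"
proof (cases "\<bar>t - q\<bar> < 1 / sqrt (real n) \<or> t \<notin> {min q (order_stat n p x)..<max q (order_stat n p x)}")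
  case True
  have "0 \<le> 4 / c\<^sup>2 * (\<bar>t - q\<bar> powr - 2 + 1 / \<epsilon>\<^sup>2) * (ecdf n x t - cdf M t)\<^sup>2"
    by (intro mult_nonneg_nonneg add_nonneg_nonneg) auto
  then show ?thesis using True by (auto simp: indicator_def)
next
  case False
  let ?w = "c * min \<bar>t - q\<bar> \<epsilon>" and ?d = "\<bar>ecdf n x t - cdf M t\<bar>"
  have far: "1 / sqrt (real n) \<le> \<bar>t - q\<bar>" and t: "t \<in> {min q (order_stat n p x)..<max q (order_stat n p x)}"
    using False by auto
  have pos: "0 < \<bar>t - q\<bar>" using far n by (smt (verit) divide_pos_pos of_nat_0_less_iff real_sqrt_gt_zero)
  have "c / sqrt (real n) \<le> c * \<bar>t - q\<bar>" using mult_left_mono[OF far, of c] c by simp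
  \<comment> \<open>Twice the rank error is at most \<open>?w\<close>: \<open>n1\<close> with
    \<open>far\<close> covers a minimum equal to \<open>\<bar>t - q\<bar>\<close>, and
    \<open>n2\<close> a minimum equal to \<open>\<epsilon>\<close>.\<close>
  then have w: "2 / real n \<le> ?w" using n1 n2 by (auto simp: min_def)
  have "?w - 1 / real n \<le> ?d"
    using order_stat_event[OF p n q t] growth[of t] by linarith
  then have wd: "?w \<le> 2 * ?d" using w by (simp add: field_simps)
  have w0: "0 < ?w" using c \<epsilon> pos by simp
  have "1 \<le> (2 * ?d)\<^sup>2 / ?w\<^sup>2"
    using power_mono[OF wd, of 2] w0 zero_less_power[OF w0, of 2] by (simp only: le_divide_eq_1_pos less_imp_le)
  also have "\<dots> = 4 / c\<^sup>2 * (1 / (min \<bar>t - q\<bar> \<epsilon>)\<^sup>2) * (ecdf n x t - cdf M t)\<^sup>2"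
    by (simp add: power_mult_distrib)
  also have "\<dots> \<le> 4 / c\<^sup>2 * (\<bar>t - q\<bar> powr - 2 + 1 / \<epsilon>\<^sup>2) * (ecdf n x t - cdf M t)\<^sup>2"
  proof (intro mult_right_mono mult_left_mono)
    \<comment> \<open>The reciprocal of a minimum is at most the sum of the reciprocals. This
      separates an integrable tail from a constant.\<close>
    show "1 / (min \<bar>t - q\<bar> \<epsilon>)\<^sup>2 \<le> \<bar>t - q\<bar> powr - 2 + 1 / \<epsilon>\<^sup>2"
      using pos \<epsilon> by (auto simp: min_def powr_minus powr_numeral divide_inverse)
  qed auto
  finally show ?thesis using far t by simp
qed

text \<open>The deviation is the length of the interval of separating \<open>t\<close>, so Tonelli
  turns its expectation into an integral of probabilities. The window of radius
  \<open>1 / sqrt n\<close> around \<open>q\<close>, with probability bounded by 1, contributes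
  \<open>2 / sqrt n\<close>. Outside it, the tail \<open>\<bar>t - q\<bar> powr - 2\<close> has
  integral \<open>2 * sqrt n\<close> and meets the variance factor \<open>1 / n\<close>; the
  constant \<open>1 / \<epsilon>\<^sup>2\<close> contributes a term of order
  \<open>1 / n\<close>.\<close>

lemma nn_integral_order_stat_deviation:
  assumes p: "0 < p" "p < 1" and n: "0 < n" and q: "cdf M q = p"
    and c: "0 < c" and \<epsilon>: "0 < \<epsilon>" and growth: "\<And>t. c * min \<bar>t - q\<bar> \<epsilon> \<le> \<bar>cdf M t - p\<bar>"
    and n1: "2 / real n \<le> c / sqrt (real n)" and n2: "2 / real n \<le> c * \<epsilon>"
    and J: "(\<integral>\<^sup>+t. ennreal (cdf M t * (1 - cdf M t)) \<partial>lborel) \<le> ennreal J" and J0: "0 \<le> J"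
  shows "(\<integral>\<^sup>+x. ennreal \<bar>order_stat n p x - q\<bar> \<partial>sample n)
    \<le> ennreal ((2 + 4 / c\<^sup>2 * (2 + J / \<epsilon>\<^sup>2)) / sqrt (real n))"
proof -
  interpret S: prob_space "sample n" by (rule prob_space_sample)
  interpret P: pair_sigma_finite "sample n" lborel ..
  let ?r = "sqrt (real n)" and ?V = "\<lambda>t. cdf M t * (1 - cdf M t)"
  let ?I = "\<lambda>x. {min q (order_stat n p x)..<max q (order_stat n p x)}"
  let ?T = "\<lambda>t. ennreal (\<bar>t - q\<bar> powr - 2) * indicator {t. 1 / ?r \<le> \<bar>t - q\<bar>} t"
  let ?W = "\<lambda>t. indicator {q - 1 / ?r<..<q + 1 / ?r} t + ennreal (4 / c\<^sup>2 / real n) * (?T t + ennreal (1 / \<epsilon>\<^sup>2) * ennreal (?V t))"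
  have r: "0 < ?r" using n by simp
  note [measurable] = borel_measurable_order_stat[OF p n]
  have slice: "(\<integral>\<^sup>+x. indicator (?I x) t \<partial>sample n) \<le> ?W t" for t
  proof (cases "\<bar>t - q\<bar> < 1 / ?r")
    case True
    have "(\<integral>\<^sup>+x. indicator (?I x) t \<partial>sample n) \<le> (\<integral>\<^sup>+x. 1 \<partial>sample n)"
      by (intro nn_integral_mono) (auto simp: indicator_def)
    also have "\<dots> = 1" by (simp add: S.emeasure_space_1)
    finally show ?thesis using True by (auto simp: indicator_def add_increasing2)
  next
    case False
    let ?K = "4 / c\<^sup>2 * (\<bar>t - q\<bar> powr - 2 + 1 / \<epsilon>\<^sup>2)"
    have K: "0 \<le> ?K" by (intro mult_nonneg_nonneg add_nonneg_nonneg) auto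
    have "(\<integral>\<^sup>+x. indicator (?I x) t \<partial>sample n)
      \<le> (\<integral>\<^sup>+x. ennreal (?K * (ecdf n x t - cdf M t)\<^sup>2) \<partial>sample n)"
    proof (intro nn_integral_mono)
      fix x
      show "indicator (?I x) t \<le> ennreal (?K * (ecdf n x t - cdf M t)\<^sup>2)"
        using order_stat_indicator_le[OF p n q c \<epsilon> growth n1 n2, of x t] False
        by (simp flip: ennreal_indicator add: ennreal_leI)
    qed
    also have "\<dots> = ennreal (?K * (?V t / real n))"
      using ecdf_variance[OF n, of t] K
      by (subst nn_integral_eq_integral) (auto simp del: times_divide_eq_left times_divide_eq_right)
    also have "\<dots> \<le> ennreal (4 / c\<^sup>2 / real n * (\<bar>t - q\<bar> powr - 2 + 1 / \<epsilon>\<^sup>2 * ?V t))"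
    proof (rule ennreal_leI)
      \<comment> \<open>Only the first summand gives up the factor \<open>?V t\<close>. The second
        keeps it, a constant not being integrable over the line.\<close>
      have "\<bar>t - q\<bar> powr - 2 * ?V t \<le> \<bar>t - q\<bar> powr - 2"
        using cdf_variance_bounds[of t] by (simp add: mult_left_le)
      then have "(\<bar>t - q\<bar> powr - 2 + 1 / \<epsilon>\<^sup>2) * ?V t \<le> \<bar>t - q\<bar> powr - 2 + 1 / \<epsilon>\<^sup>2 * ?V t"
        by (simp add: algebra_simps)
      from mult_left_mono[OF this, of "4 / c\<^sup>2 / real n"]
      show "?K * (?V t / real n) \<le> 4 / c\<^sup>2 / real n * (\<bar>t - q\<bar> powr - 2 + 1 / \<epsilon>\<^sup>2 * ?V t)"
        using c by (simp only: times_divide_eq_left times_divide_eq_right divide_divide_eq_left mult.assoc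
            mult.commute[of "real n"]) simp
    qed
    also have "\<dots> = ennreal (4 / c\<^sup>2 / real n) * (?T t + ennreal (1 / \<epsilon>\<^sup>2) * ennreal (?V t))"
    proof -
      have "ennreal (A * (D + G * V)) = ennreal A * (ennreal D + ennreal G * ennreal V)"
        if "0 \<le> A" "0 \<le> D" "0 \<le> G" "0 \<le> V" for A D G V
        using that by (simp add: ennreal_mult)
      from this[of "4 / c\<^sup>2 / real n" "\<bar>t - q\<bar> powr - 2" "1 / \<epsilon>\<^sup>2" "?V t"] False cdf_variance_bounds[of t]
      show ?thesis by simp
    qed
    finally show ?thesis by (simp add: add_increasing)
  qed
  have "(\<integral>\<^sup>+x. ennreal \<bar>order_stat n p x - q\<bar> \<partial>sample n) = (\<integral>\<^sup>+x. \<integral>\<^sup>+t. indicator (?I x) t \<partial>lborel \<partial>sample n)"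
    by (intro nn_integral_cong) (auto simp: min_def max_def)
  also have "\<dots> = (\<integral>\<^sup>+t. \<integral>\<^sup>+x. indicator (?I x) t \<partial>sample n \<partial>lborel)"
  proof (rule P.Fubini'[symmetric])
    have eq: "(\<lambda>(x, t). indicator (?I x) t :: ennreal) = (\<lambda>z.
      if min q (order_stat n p (fst z)) \<le> snd z \<and> snd z < max q (order_stat n p (fst z)) then 1 else 0)"
      by (auto simp: indicator_def fun_eq_iff)
    show "(\<lambda>(x, t). indicator (?I x) t :: ennreal) \<in> borel_measurable (sample n \<Otimes>\<^sub>M lborel)"
      unfolding eq by measurable
  qed
  also have "\<dots> \<le> (\<integral>\<^sup>+t. ?W t \<partial>lborel)" by (intro nn_integral_mono slice)
  also have "\<dots> = (\<integral>\<^sup>+t. indicator {q - 1 / ?r<..<q + 1 / ?r} t \<partial>lborel)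
     + ennreal (4 / c\<^sup>2 / real n) * ((\<integral>\<^sup>+t. ?T t \<partial>lborel) + ennreal (1 / \<epsilon>\<^sup>2) * (\<integral>\<^sup>+t. ennreal (?V t) \<partial>lborel))"
    by (simp add: nn_integral_add nn_integral_cmult)
  also have "(\<integral>\<^sup>+t. ?T t \<partial>lborel) = ennreal (2 * ?r)"
    using r nn_integral_powr_tails[of 2 "1 / ?r" q] by (simp add: powr_minus powr_one)
  also have "(\<integral>\<^sup>+t. indicator {q - 1 / ?r<..<q + 1 / ?r} t \<partial>lborel) = ennreal (2 / ?r)"
    using r by simp
  also have "ennreal (2 / ?r) + ennreal (4 / c\<^sup>2 / real n) * (ennreal (2 * ?r) + ennreal (1 / \<epsilon>\<^sup>2) * (\<integral>\<^sup>+t. ennreal (?V t) \<partial>lborel))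
    \<le> ennreal (2 / ?r) + ennreal (4 / c\<^sup>2 / real n) * (ennreal (2 * ?r) + ennreal (1 / \<epsilon>\<^sup>2) * ennreal J)"
    by (intro add_left_mono mult_left_mono J) auto
  also have "\<dots> = ennreal (2 / ?r + 4 / c\<^sup>2 / real n * (2 * ?r + 1 / \<epsilon>\<^sup>2 * J))"
    using J0 by (simp flip: ennreal_mult ennreal_plus)
  also have "\<dots> \<le> ennreal ((2 + 4 / c\<^sup>2 * (2 + J / \<epsilon>\<^sup>2)) / ?r)"
  proof (rule ennreal_leI)
    have "1 \<le> ?r" using n by simp
    then have "J / \<epsilon>\<^sup>2 \<le> J / \<epsilon>\<^sup>2 * ?r" using mult_left_mono[of 1 ?r "J / \<epsilon>\<^sup>2"] J0 by simp
    then have "4 / c\<^sup>2 / real n * (2 * ?r + J / \<epsilon>\<^sup>2) \<le> 4 / c\<^sup>2 / real n * (2 * ?r + J / \<epsilon>\<^sup>2 * ?r)"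
      by (intro mult_left_mono) auto
    also have "\<dots> = 4 / c\<^sup>2 * (2 + J / \<epsilon>\<^sup>2) * (?r / real n)"
      by (simp add: algebra_simps)
    also have "?r / real n = 1 / ?r" using r by (simp add: field_simps)
    finally show "2 / ?r + 4 / c\<^sup>2 / real n * (2 * ?r + 1 / \<epsilon>\<^sup>2 * J) \<le> (2 + 4 / c\<^sup>2 * (2 + J / \<epsilon>\<^sup>2)) / ?r"
      by (simp add: add_divide_distrib)
  qed
  finally show ?thesis .
qed

end

section \<open>Expected social costs and Wasserstein distances\<close>

text \<open>The bound is free of the reports, so \<open>y\<close> may depend on them as the
  mechanism's output does. A sum over the facilities lets expectations be taken one order statistic
  at a time.\<close>

lemma SC_perturb:
  assumes k: "1 \<le> k"
  shows "\<bar>SC n k x y - SC n k x y'\<bar> \<le> (\<Sum>j\<in>{1..k}. \<bar>y j - y' j\<bar>)"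
proof (cases "n = 0")
  case False
  let ?d = "\<Sum>j\<in>{1..k}. \<bar>y j - y' j\<bar>"
  have d: "\<bar>y j - y' j\<bar> \<le> ?d" "\<bar>y' j - y j\<bar> \<le> ?d" if "j \<in> {1..k}" for j
    using that member_le_sum[of j "{1..k}" "\<lambda>j. \<bar>y j - y' j\<bar>"] by (auto simp: abs_minus_commute)
  have "\<bar>\<Sum>i<n. mindist k y (x i) - mindist k y' (x i)\<bar> \<le> (\<Sum>i<n. ?d)"
  proof (intro order_trans[OF sum_abs] sum_mono)
    fix i
    have "mindist k y (x i) \<le> mindist k y' (x i) + ?d" using d by (intro mindist_perturb[OF k]) auto
    moreover have "mindist k y' (x i) \<le> mindist k y (x i) + ?d" using d by (intro mindist_perturb[OF k]) auto
    ultimately show "\<bar>mindist k y (x i) - mindist k y' (x i)\<bar> \<le> ?d" by linarith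
  qed
  then have "\<bar>\<Sum>i<n. mindist k y (x i) - mindist k y' (x i)\<bar> / real n \<le> ?d"
    using False by (simp add: divide_le_eq mult.commute)
  moreover have "SC n k x y - SC n k x y' = (\<Sum>i<n. mindist k y (x i) - mindist k y' (x i)) / real n"
    by (simp add: SC_eq_mindist sum_subtractf diff_divide_distrib)
  ultimately show ?thesis by simp
qed (simp add: SC_def sum_nonneg)

lemma SC_nonneg: "1 \<le> k \<Longrightarrow> 0 \<le> SC n k x y"
  using mindist_nonneg by (simp add: SC_eq_mindist sum_nonneg)

lemma bdd_below_SC: "1 \<le> k \<Longrightarrow> bdd_below (range (SC n k x))"
  using SC_nonneg by (intro bdd_belowI2)

lemma SC_opt_eq_INF: "SC_opt n k x = (INF y. SC n k x y)"
  by (simp add: SC_opt_def full_SetCompr_eq)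

lemma SC_opt_le: "1 \<le> k \<Longrightarrow> SC_opt n k x \<le> SC n k x y"
  unfolding SC_opt_eq_INF by (rule cINF_lower[OF bdd_below_SC]) auto

lemma SC_opt_greatest: "(\<And>y. c \<le> SC n k x y) \<Longrightarrow> c \<le> SC_opt n k x"
  unfolding SC_opt_eq_INF by (rule cINF_greatest) auto

text \<open>Reduction to a countable infimum, which makes \<open>SC_opt\<close> measurable.\<close>

lemma SC_opt_eq_INF_rat:
  assumes k: "1 \<le> k"
  shows "SC_opt n k x = (INF y\<in>{1..k} \<rightarrow>\<^sub>E \<rat>. SC n k x y)"
proof (rule antisym)
  have ne: "{1..k} \<rightarrow>\<^sub>E (\<rat> :: real set) \<noteq> {}" by (auto simp: PiE_eq_empty_iff)
  show "SC_opt n k x \<le> (INF y\<in>{1..k} \<rightarrow>\<^sub>E \<rat>. SC n k x y)"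
    using ne by (intro cINF_greatest SC_opt_le[OF k])
  show "(INF y\<in>{1..k} \<rightarrow>\<^sub>E \<rat>. SC n k x y) \<le> SC_opt n k x"
  proof (rule SC_opt_greatest, rule field_le_epsilon)
    fix y :: "nat \<Rightarrow> real" and e :: real assume e: "0 < e"
    have "\<exists>r\<in>\<rat>. y j < r \<and> r < y j + e / real k" for j
      using Rats_dense_in_real[of "y j" "y j + e / real k"] e k by auto
    then obtain r where r: "\<And>j. r j \<in> \<rat>" "\<And>j. y j < r j" "\<And>j. r j < y j + e / real k"
      by metis
    \<comment> \<open>\<open>SC\<close> reads only the values on \<open>{1..k}\<close>. Restriction
      yields an extensional function, and of those with rational values there are only countably
      many.\<close>
    define r' where "r' = restrict r {1..k}"
    have "(INF y\<in>{1..k} \<rightarrow>\<^sub>E \<rat>. SC n k x y) \<le> SC n k x r'"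
      using r(1) by (intro cINF_lower bdd_belowI2[where m = 0] SC_nonneg[OF k]) (auto simp: r'_def)
    also have "\<dots> \<le> SC n k x y + (\<Sum>j\<in>{1..k}. \<bar>r' j - y j\<bar>)"
      using SC_perturb[OF k, of n x r' y] by linarith
    also have "(\<Sum>j\<in>{1..k}. \<bar>r' j - y j\<bar>) \<le> (\<Sum>j\<in>{1..k}. e / real k)"
    proof (intro sum_mono)
      fix j assume "j \<in> {1..k}"
      then show "\<bar>r' j - y j\<bar> \<le> e / real k" using r(2,3)[of j] by (auto simp: r'_def)
    qed
    also have "\<dots> = e" using k by simp
    finally show "(INF y\<in>{1..k} \<rightarrow>\<^sub>E \<rat>. SC n k x y) \<le> SC n k x y + e" by simp
  qed
qed

section \<open>Measurability and expectations of the social costs\<close>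

context real_distribution
begin

lemma integral_sample_component:
  fixes f :: "real \<Rightarrow> real"
  assumes i: "i < n" and f: "integrable M f"
  shows "integrable (sample n) (\<lambda>x. f (x i))" and "(\<integral>x. f (x i) \<partial>sample n) = (\<integral>z. f z \<partial>M)"
proof -
  have d: "distr (sample n) M (\<lambda>x. x i) = M"
    using i by (intro distr_PiM_component[of "{..<n}" "\<lambda>_. M"] prob_space_axioms) auto
  have m: "(\<lambda>x. x i) \<in> sample n \<rightarrow>\<^sub>M M" using i by (intro measurable_component_singleton) auto
  show "integrable (sample n) (\<lambda>x. f (x i))"
    using f integrable_distr[OF m, of f] d by simp
  show "(\<integral>x. f (x i) \<partial>sample n) = (\<integral>z. f z \<partial>M)"
    using integral_distr[OF m, of f] f d by simp
qed

lemma expectation_SC: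
  assumes k: "1 \<le> k" and n: "0 < n" and m1: "integrable M (\<lambda>x. \<bar>x\<bar>)"
  shows "integrable (sample n) (\<lambda>x. SC n k x y)"
    and "(\<integral>x. SC n k x y \<partial>sample n) = (\<integral>x. mindist k y x \<partial>M)"
proof -
  note I = integral_sample_component[OF _ integrable_mindist[OF k m1]]
  show "integrable (sample n) (\<lambda>x. SC n k x y)"
    unfolding SC_eq_mindist using I(1) by (intro integrable_divide_zero Bochner_Integration.integrable_sum) auto
  show "(\<integral>x. SC n k x y \<partial>sample n) = (\<integral>x. mindist k y x \<partial>M)"
    unfolding SC_eq_mindist using n I by (simp add: Bochner_Integration.integral_sum)
qed

lemma borel_measurable_SC:
  assumes k: "1 \<le> k" and y: "\<And>j. j \<in> {1..k} \<Longrightarrow> (\<lambda>x. y x j) \<in> borel_measurable (sample n)"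
  shows "(\<lambda>x. SC n k x (y x)) \<in> borel_measurable (sample n)"
  unfolding SC_def using y
  by (intro borel_measurable_times borel_measurable_sum borel_measurable_Min borel_measurable_abs
      borel_measurable_diff borel_measurable_const borel_measurable_sample_component) auto

lemma borel_measurable_SC_opt:
  assumes k: "1 \<le> k" shows "SC_opt n k \<in> borel_measurable (sample n)"
proof -
  have "countable ({1..k} \<rightarrow>\<^sub>E (\<rat> :: real set))" by (intro countable_PiE countable_rat) auto
  then have "(\<lambda>x. INF y\<in>{1..k} \<rightarrow>\<^sub>E \<rat>. SC n k x y) \<in> borel_measurable (sample n)"
    by (intro borel_measurable_cINF_real borel_measurable_SC[OF k]) auto
  then show ?thesis by (simp add: SC_opt_eq_INF_rat[OF k, abs_def])
qed

text \<open>Any fixed placement costs at least the optimum, which gives the upper bound without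
  error. The lower bound rests on the deviation estimate being uniform in \<open>y\<close>, so that
  it survives the infimum inside the expectation.\<close>

lemma E_SC_opt_bounds:
  assumes k: "1 \<le> k" and n: "0 < n" and m1: "integrable M (\<lambda>x. \<bar>x\<bar>)"
  shows "E_SC_opt M n k \<le> (\<integral>x. mindist k y x \<partial>M)"
    and "(\<integral>\<^sup>+t. ennreal (sqrt (cdf M t * (1 - cdf M t))) \<partial>lborel) \<le> ennreal J \<Longrightarrow> 0 \<le> J \<Longrightarrow>
      (\<And>y. b \<le> (\<integral>x. mindist k y x \<partial>M)) \<Longrightarrow> b - J / sqrt (real n) \<le> E_SC_opt M n k"
proof -
  interpret S: prob_space "sample n" by (rule prob_space_sample)
  interpret P: pair_sigma_finite "sample n" lborel ..
  have nonneg: "0 \<le> SC_opt n k x" for x using SC_nonneg[OF k] by (rule SC_opt_greatest)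
  note [measurable] = borel_measurable_SC_opt[OF k, of n]
  have int: "integrable (sample n) (SC_opt n k)"
    by (rule Bochner_Integration.integrable_bound[OF expectation_SC(1)[OF k n m1]])
       (auto simp: nonneg intro!: order_trans[OF SC_opt_le[OF k] abs_ge_self])
  show "E_SC_opt M n k \<le> (\<integral>x. mindist k y x \<partial>M)"
    unfolding E_SC_opt_def expectation_SC(2)[OF k n m1, of y, symmetric]
    by (intro integral_mono int expectation_SC(1)[OF k n m1] SC_opt_le[OF k])
  assume J: "(\<integral>\<^sup>+t. ennreal (sqrt (cdf M t * (1 - cdf M t))) \<partial>lborel) \<le> ennreal J" "0 \<le> J"
    and b: "\<And>y. b \<le> (\<integral>x. mindist k y x \<partial>M)"
  let ?D = "\<lambda>x. \<integral>\<^sup>+t. ennreal \<bar>ecdf n x t - cdf M t\<bar> \<partial>lborel"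
  \<comment> \<open>An infinite deviation makes the claim trivial; a finite one is a constant
    \<open>d\<close> common to all \<open>y\<close>.\<close>
  have pointwise: "ennreal b \<le> ennreal (SC_opt n k x) + ?D x" for x
  proof (cases "?D x")
    case (real d)
    have "b - d \<le> SC n k x y" for y
    proof -
      have "ennreal b \<le> ennreal (SC n k x y + d)"
        using order_trans[OF ennreal_leI[OF b[of y]] expectation_mindist_le_SC[OF k n m1, of y x]]
          real SC_nonneg[OF k, of n x y] by simp
      then show ?thesis
        using real SC_nonneg[OF k, of n x y] by (simp add: ennreal_le_iff del: ennreal_plus)
    qed
    then have "b \<le> SC_opt n k x + d" using SC_opt_greatest[of "b - d" n k x] by simp
    then show ?thesis using real nonneg[of x] by (simp flip: ennreal_plus add: ennreal_leI)
  qed simp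
  have "ennreal b = (\<integral>\<^sup>+x. ennreal b \<partial>sample n)" by (simp add: S.emeasure_space_1)
  also have "\<dots> \<le> (\<integral>\<^sup>+x. ennreal (SC_opt n k x) + ?D x \<partial>sample n)"
    by (intro nn_integral_mono pointwise)
  also have "\<dots> = (\<integral>\<^sup>+x. ennreal (SC_opt n k x) \<partial>sample n) + (\<integral>\<^sup>+x. ?D x \<partial>sample n)"
    by (intro nn_integral_add) measurable
  also have "(\<integral>\<^sup>+x. ennreal (SC_opt n k x) \<partial>sample n) = ennreal (E_SC_opt M n k)"
    unfolding E_SC_opt_def using int nonneg by (intro nn_integral_eq_integral) auto
  also have "(\<integral>\<^sup>+x. ?D x \<partial>sample n) \<le> ennreal J * ennreal (1 / sqrt (real n))"
    using order_trans[OF sample_nn_integral_ecdf_deviation[OF n] mult_right_mono[OF J(1)]] by simp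
  also have "\<dots> = ennreal (J / sqrt (real n))" using J(2) by (simp flip: ennreal_mult)
  finally have *: "ennreal b \<le> ennreal (E_SC_opt M n k) + ennreal (J / sqrt (real n))"
    by (simp add: add_left_mono)
  have "0 \<le> E_SC_opt M n k" unfolding E_SC_opt_def using nonneg by (intro integral_nonneg_AE) auto
  with * J(2) show "b - J / sqrt (real n) \<le> E_SC_opt M n k"
    by (simp flip: ennreal_plus add: ennreal_le_iff)
qed

text \<open>The cost at the fixed vector \<open>q\<close> has exactly the limiting expectation, and
  moving the facilities there costs at most the sum of their displacements. Integrability of
  \<open>SC_v\<close> is recovered from that of the difference.\<close>

lemma E_SC_v_deviation:
  assumes k: "1 \<le> k" and n: "0 < n" and m1: "integrable M (\<lambda>x. \<bar>x\<bar>)"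
    and v: "\<And>j. j \<in> {1..k} \<Longrightarrow> 0 < v j \<and> v j < 1"
    and dev: "\<And>j. j \<in> {1..k} \<Longrightarrow>
      (\<integral>\<^sup>+x. ennreal \<bar>order_stat n (v j) x - q j\<bar> \<partial>sample n) \<le> ennreal (d j)"
    and d: "\<And>j. j \<in> {1..k} \<Longrightarrow> 0 \<le> d j"
  shows "\<bar>E_SC_v M n k v - (\<integral>x. mindist k q x \<partial>M)\<bar> \<le> (\<Sum>j\<in>{1..k}. d j)"
proof -
  have [measurable]: "order_stat n (v j) \<in> borel_measurable (sample n)" if "j \<in> {1..k}" for j
    using v[OF that] n by (intro borel_measurable_order_stat) auto
  have osi: "integrable (sample n) (\<lambda>x. \<bar>order_stat n (v j) x - q j\<bar>)" if "j \<in> {1..k}" for j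
  proof (rule integrableI_bounded)
    show "(\<integral>\<^sup>+x. ennreal (norm \<bar>order_stat n (v j) x - q j\<bar>) \<partial>sample n) < \<infinity>"
      using le_less_trans[OF dev[OF that]] by simp
  qed (use that in measurable)
  have osd: "(\<integral>x. \<bar>order_stat n (v j) x - q j\<bar> \<partial>sample n) \<le> d j" if "j \<in> {1..k}" for j
    using dev[OF that] d[OF that] nn_integral_eq_integral[OF osi[OF that]] by (simp add: ennreal_le_iff)
  let ?g = "\<lambda>x. \<Sum>j\<in>{1..k}. \<bar>order_stat n (v j) x - q j\<bar>"
  have gint: "integrable (sample n) ?g" using osi by (intro Bochner_Integration.integrable_sum)
  have bd: "\<bar>SC_v n k v x - SC n k x q\<bar> \<le> ?g x" for x
    using SC_perturb[OF k, of n x "PM n v x" q] by (simp add: SC_v_def PM_eq_order_stat)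
  have m: "SC_v n k v \<in> borel_measurable (sample n)"
    unfolding SC_v_def[abs_def]
    by (intro borel_measurable_SC[OF k]) (simp add: PM_eq_order_stat)
  have qi: "integrable (sample n) (\<lambda>x. SC n k x q)" by (rule expectation_SC(1)[OF k n m1])
  have diff: "integrable (sample n) (\<lambda>x. SC_v n k v x - SC n k x q)"
    using m qi bd by (intro Bochner_Integration.integrable_bound[OF gint]) (auto simp: sum_nonneg)
  have "integrable (sample n) (SC_v n k v)"
    using Bochner_Integration.integrable_add[OF diff qi] by simp
  then have "E_SC_v M n k v - (\<integral>x. mindist k q x \<partial>M) = (\<integral>x. SC_v n k v x - SC n k x q \<partial>sample n)"
    unfolding E_SC_v_def expectation_SC(2)[OF k n m1, of q, symmetric] using qi by simp
  also have "\<bar>\<dots>\<bar> \<le> (\<integral>x. ?g x \<partial>sample n)"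
    by (rule order_trans[OF integral_abs_bound integral_mono[OF integrable_abs[OF diff] gint bd]])
  also have "\<dots> = (\<Sum>j\<in>{1..k}. \<integral>x. \<bar>order_stat n (v j) x - q j\<bar> \<partial>sample n)"
    using osi by (rule Bochner_Integration.integral_sum)
  also have "\<dots> \<le> (\<Sum>j\<in>{1..k}. d j)" using osd by (rule sum_mono)
  finally show ?thesis .
qed

end

section \<open>Finitely supported measures and the Wasserstein distance to them\<close>

lemma emeasure_distr_point_measure:
  fixes y :: "nat \<Rightarrow> real"
  assumes A: "A \<in> sets borel"
  shows "emeasure (distr (point_measure {1..k} (\<lambda>j. ennreal (w j))) borel y) A
    = (\<Sum>j\<in>{1..k}. ennreal (w j) * indicator A (y j))"
proof -
  have "emeasure (distr (point_measure {1..k} (\<lambda>j. ennreal (w j))) borel y) A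
      = (\<integral>\<^sup>+j. indicator A (y j) \<partial>point_measure {1..k} (\<lambda>j. ennreal (w j)))"
    using A by (subst nn_integral_indicator[symmetric], simp, subst nn_integral_distr)
      (auto simp: point_measure_def)
  then show ?thesis by (simp add: nn_integral_point_measure_finite)
qed

text \<open>\<open>measure_of\<close> falls back to the value 0 unless its set function is a
  measure. The push-forward of a weighted point measure is one and agrees with the defining sum on
  Borel sets.\<close>

lemma discrete_measure_eq_distr:
  "discrete_measure k w y = distr (point_measure {1..k} (\<lambda>j. ennreal (w j))) borel y"
proof -
  let ?N = "distr (point_measure {1..k} (\<lambda>j. ennreal (w j))) borel y"
  have "discrete_measure k w y = measure_of (space ?N) (sets ?N) (emeasure ?N)"
    unfolding discrete_measure_def space_distr sets_distr space_borel
    by (intro measure_of_eq)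
       (auto simp: sets.sigma_sets_eq[of borel, simplified] emeasure_distr_point_measure
          simp del: One_nat_def)
  then show ?thesis by (simp only: measure_of_of_measure)
qed

lemma sets_discrete_measure [simp]: "sets (discrete_measure k w y) = sets borel"
  by (simp add: discrete_measure_eq_distr)

lemma emeasure_discrete_measure:
  "A \<in> sets borel \<Longrightarrow>
    emeasure (discrete_measure k w y) A = (\<Sum>j\<in>{1..k}. ennreal (w j) * indicator A (y j))"
  unfolding discrete_measure_eq_distr by (rule emeasure_distr_point_measure)

context real_distribution
begin

text \<open>Under every coupling the second coordinate is almost surely one of the
  \<open>y j\<close>, so the transport distance is at least that to the nearest of them. The bound
  is the same for all weights \<open>w\<close>.\<close>

lemma W1_discrete_ge:
  assumes k: "1 \<le> k" and m1: "integrable M (\<lambda>x. \<bar>x\<bar>)"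
  shows "ennreal (\<integral>x. mindist k y x \<partial>M) \<le> W1 M (discrete_measure k w y)"
  unfolding W1_def
proof (rule Inf_greatest)
  fix u
  assume "u \<in> {(\<integral>\<^sup>+p. ennreal \<bar>fst p - snd p\<bar> \<partial>\<pi>) | \<pi>. prob_space \<pi> \<and>
    sets \<pi> = sets (borel \<Otimes>\<^sub>M borel) \<and> distr \<pi> borel fst = M \<and>
    distr \<pi> borel snd = discrete_measure k w y}"
  then obtain \<pi> :: "(real \<times> real) measure"
    where u: "u = (\<integral>\<^sup>+p. ennreal \<bar>fst p - snd p\<bar> \<partial>\<pi>)"
      and s: "sets \<pi> = sets (borel \<Otimes>\<^sub>M borel)" and f: "distr \<pi> borel fst = M"
      and d: "distr \<pi> borel snd = discrete_measure k w y"
    by blast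
  have [measurable]: "mindist k y \<in> borel_measurable borel" using k by simp
  have [measurable]: "fst \<in> borel_measurable \<pi>" "snd \<in> borel_measurable \<pi>"
    using measurable_cong_sets[OF s refl] by auto
  have [measurable]: "y ` {1..k} \<in> sets borel" by (intro borel_closed finite_imp_closed) auto
  have "AE z in discrete_measure k w y. z \<in> y ` {1..k}"
  proof (rule AE_I)
    show "emeasure (discrete_measure k w y) (- y ` {1..k}) = 0"
      by (subst emeasure_discrete_measure) (auto simp del: One_nat_def intro!: borel_comp)
  qed (auto simp del: One_nat_def intro!: borel_comp)
  then have "AE z in distr \<pi> borel snd. z \<in> y ` {1..k}" by (simp only: d)
  then have ae: "AE p in \<pi>. snd p \<in> y ` {1..k}"
    by (subst (asm) AE_distr_iff) (auto simp del: One_nat_def)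
  have "ennreal (\<integral>x. mindist k y x \<partial>M) = (\<integral>\<^sup>+x. ennreal (mindist k y x) \<partial>M)"
    using mindist_nonneg[OF k] by (intro nn_integral_eq_integral[symmetric] integrable_mindist[OF k m1]) auto
  also have "\<dots> = (\<integral>\<^sup>+x. ennreal (mindist k y x) \<partial>distr \<pi> borel fst)" by (simp add: f)
  also have "\<dots> = (\<integral>\<^sup>+p. ennreal (mindist k y (fst p)) \<partial>\<pi>)" by (rule nn_integral_distr) measurable
  also have "\<dots> \<le> (\<integral>\<^sup>+p. ennreal \<bar>fst p - snd p\<bar> \<partial>\<pi>)"
    using ae by (intro nn_integral_mono_AE) (auto elim!: eventually_mono intro!: ennreal_leI mindist_le)
  finally show "ennreal (\<integral>x. mindist k y x \<partial>M) \<le> u" unfolding u .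
qed

text \<open>The coupling of \<open>x\<close> with \<open>y (J x)\<close> attains the lower bound.
  The assignment \<open>J\<close> is left open because \<open>INF_W1_Pk\<close> uses
  \<open>nearest\<close> while \<open>W1_nu_Q\<close> uses cells between midpoints, which can
  resolve ties differently when quantiles coincide.\<close>

lemma W1_discrete_nearest:
  assumes k: "1 \<le> k" and m1: "integrable M (\<lambda>x. \<bar>x\<bar>)"
    and J [measurable]: "J \<in> borel \<rightarrow>\<^sub>M count_space UNIV" and J_range: "\<And>x. J x \<in> {1..k}"
    and J_nearest: "\<And>x. \<bar>x - y (J x)\<bar> = mindist k y x"
  shows "W1 M (discrete_measure k (\<lambda>j. prob {x. J x = j}) y) = ennreal (\<integral>x. mindist k y x \<partial>M)"
proof (rule antisym[OF _ W1_discrete_ge[OF k m1]])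
  have [measurable]: "(\<lambda>x. y (J x)) \<in> borel_measurable borel"
    by (rule measurable_compose[OF J]) simp
  let ?\<pi> = "distr M (borel \<Otimes>\<^sub>M borel) (\<lambda>x. (x, y (J x)))"
  have "distr ?\<pi> borel snd = discrete_measure k (\<lambda>j. prob {x. J x = j}) y"
  proof (rule measure_eqI)
    fix A assume "A \<in> sets (distr ?\<pi> borel snd)"
    then have A [measurable]: "A \<in> sets borel" by simp
    have "emeasure (distr ?\<pi> borel snd) A = emeasure M {x. y (J x) \<in> A}"
      by (simp add: distr_distr comp_def emeasure_distr vimage_def)
    also have "{x. y (J x) \<in> A} = (\<Union>j\<in>{j\<in>{1..k}. y j \<in> A}. {x. J x = j})"
      using J_range by auto
    also have "emeasure M \<dots> = (\<Sum>j\<in>{j\<in>{1..k}. y j \<in> A}. emeasure M {x. J x = j})"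
      by (intro sum_emeasure[symmetric]) (auto simp: disjoint_family_on_def)
    also have "\<dots> = (\<Sum>j\<in>{1..k}. ennreal (prob {x. J x = j}) * indicator A (y j))"
      unfolding emeasure_eq_measure by (intro sum.mono_neutral_cong_left) (auto simp: indicator_def)
    finally show "emeasure (distr ?\<pi> borel snd) A = emeasure (discrete_measure k (\<lambda>j. prob {x. J x = j}) y) A"
      by (simp add: emeasure_discrete_measure)
  qed simp
  moreover have "distr ?\<pi> borel fst = M"
    by (simp add: distr_distr comp_def) (metis distr_id2 events_eq_borel)
  moreover have "prob_space ?\<pi>" by (rule prob_space_distr) simp
  ultimately have "W1 M (discrete_measure k (\<lambda>j. prob {x. J x = j}) y) \<le> (\<integral>\<^sup>+p. ennreal \<bar>fst p - snd p\<bar> \<partial>?\<pi>)"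
    unfolding W1_def by (intro Inf_lower) auto
  also have "\<dots> = (\<integral>\<^sup>+x. ennreal (mindist k y x) \<partial>M)"
    by (subst nn_integral_distr) (auto simp: J_nearest)
  also have "\<dots> = ennreal (\<integral>x. mindist k y x \<partial>M)"
    using mindist_nonneg[OF k] by (intro nn_integral_eq_integral integrable_mindist[OF k m1]) auto
  finally show "W1 M (discrete_measure k (\<lambda>j. prob {x. J x = j}) y) \<le> ennreal (\<integral>x. mindist k y x \<partial>M)" .
qed

text \<open>For given points the masses of the nearest-point cells are optimal weights, so only the
  choice of the points remains.\<close>

lemma INF_W1_Pk:
  assumes k: "1 \<le> k" and m1: "integrable M (\<lambda>x. \<bar>x\<bar>)"
  shows "(INF \<nu>\<in>Pk k. W1 M \<nu>) = (INF y. ennreal (\<integral>x. mindist k y x \<partial>M))"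
proof (rule antisym)
  show "(INF y. ennreal (\<integral>x. mindist k y x \<partial>M)) \<le> (INF \<nu>\<in>Pk k. W1 M \<nu>)"
  proof (rule INF_greatest)
    fix \<nu> assume "\<nu> \<in> Pk k"
    then obtain w y where \<nu>: "\<nu> = discrete_measure k w y" by (auto simp: Pk_def)
    have "(INF y. ennreal (\<integral>x. mindist k y x \<partial>M)) \<le> ennreal (\<integral>x. mindist k y x \<partial>M)"
      by (rule INF_lower) simp
    also have "\<dots> \<le> W1 M \<nu>" unfolding \<nu> by (rule W1_discrete_ge[OF k m1])
    finally show "(INF y. ennreal (\<integral>x. mindist k y x \<partial>M)) \<le> W1 M \<nu>" .
  qed
  show "(INF \<nu>\<in>Pk k. W1 M \<nu>) \<le> (INF y. ennreal (\<integral>x. mindist k y x \<partial>M))"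
  proof (rule INF_greatest)
    fix y
    let ?w = "\<lambda>j. prob {x. nearest k y x = j}"
    have [measurable]: "nearest k y \<in> borel \<rightarrow>\<^sub>M count_space UNIV" by (rule measurable_nearest[OF k])
    have "(\<Sum>j\<in>{1..k}. ?w j) = prob (\<Union>j\<in>{1..k}. {x. nearest k y x = j})"
      by (intro finite_measure_finite_Union[symmetric]) (auto simp: disjoint_family_on_def)
    also have "(\<Union>j\<in>{1..k}. {x. nearest k y x = j}) = space M"
      using nearest(1)[OF k, of y] by auto
    finally have "discrete_measure k ?w y \<in> Pk k"
      unfolding Pk_def
      by (intro CollectI exI[of _ ?w] exI[of _ y]) (auto simp: prob_space[unfolded space_eq_univ])
    then show "(INF \<nu>\<in>Pk k. W1 M \<nu>) \<le> ennreal (\<integral>x. mindist k y x \<partial>M)"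
      using W1_discrete_nearest[OF k m1 measurable_nearest[OF k] nearest(1)[OF k] nearest(2)[OF k], of y]
      by (intro INF_lower2) auto
  qed
qed

text \<open>For nondecreasing points, cutting at consecutive midpoints sends each \<open>x\<close>
  to a nearest point, and the weights of \<open>nu_Q\<close> are the masses of these cells.\<close>

lemma W1_nu_Q:
  assumes k: "1 \<le> k" and m1: "integrable M (\<lambda>x. \<bar>x\<bar>)"
    and mono: "\<And>i j. 1 \<le> i \<Longrightarrow> i \<le> j \<Longrightarrow> j \<le> k \<Longrightarrow> quantile M (v i) \<le> quantile M (v j)"
  shows "W1 M (nu_Q M k v) = ennreal (\<integral>x. mindist k (\<lambda>i. quantile M (v i)) x \<partial>M)"
proof -
  define q where "q i = quantile M (v i)" for i
  define z where "z i = (q i + q (Suc i)) / 2" for i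
  \<comment> \<open>Index of the cell containing \<open>x\<close>. The clause
    \<open>k \<le> i\<close> makes the last cell unbounded and avoids \<open>z k\<close>, which
    would refer to a percentile beyond the vector.\<close>
  define J where "J x = (LEAST i. 1 \<le> i \<and> (k \<le> i \<or> x \<le> z i))" for x
  have q: "q i \<le> q j" if "1 \<le> i" "i \<le> j" "j \<le> k" for i j using mono that by (simp add: q_def)
  have z: "z i \<le> z j" if "1 \<le> i" "i \<le> j" "j < k" for i j
    using q[of i j] q[of "Suc i" "Suc j"] that by (simp add: z_def)
  have [measurable]: "J \<in> borel \<rightarrow>\<^sub>M count_space UNIV" unfolding J_def by measurable
  have J1: "1 \<le> J x \<and> (k \<le> J x \<or> x \<le> z (J x))" for x
    unfolding J_def by (rule LeastI[of _ k]) (use k in auto)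
  have J2: "J x \<le> i" if "1 \<le> i" "k \<le> i \<or> x \<le> z i" for x i
    unfolding J_def by (rule Least_le) (use that in auto)
  have J_range: "J x \<in> {1..k}" for x using J1[of x] J2[of k x] k by auto
  have J_nearest: "\<bar>x - q (J x)\<bar> = mindist k q x" for x
  proof (rule antisym[OF mindist_greatest[OF k] mindist_le[OF J_range]])
    fix j assume j: "j \<in> {1..k}"
    let ?i = "J x"
    have i: "1 \<le> ?i" "?i \<le> k" using J_range[of x] by auto
    consider "j = ?i" | "?i < j" | "j < ?i" by linarith
    then show "\<bar>x - q ?i\<bar> \<le> \<bar>x - q j\<bar>"
    proof cases
      case 2
      then have "x \<le> z ?i" using J1[of x] j by auto
      moreover have "q ?i \<le> q (Suc ?i)" "q (Suc ?i) \<le> q j" using 2 i j by (auto intro!: q)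
      ultimately show ?thesis by (auto simp: z_def abs_if field_simps)
    next
      case 3
      define l where "l = ?i - 1"
      have l: "?i = Suc l" "1 \<le> l" "j \<le> l" using 3 j by (auto simp: l_def)
      have "\<not> x \<le> z l" using J2[of l x] l by auto
      moreover have "q j \<le> q l" "q l \<le> q (Suc l)" using l i j by (auto intro!: q)
      ultimately show ?thesis unfolding l(1) by (auto simp: z_def abs_if field_simps)
    qed simp
  qed
  \<comment> \<open>The first \<open>i\<close> cells together form the half-line
    \<open>{..z i}\<close>. The boundary values 0 and 1 of \<open>F_z\<close> belong to the empty
    union and to the whole line.\<close>
  have cum: "prob {x. J x \<le> i} = F_z M k v i" for i
  proof -
    consider "i = 0" | "k \<le> i" "i \<noteq> 0" | "1 \<le> i" "i < k" by linarith
    then show ?thesis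
    proof cases
      case 1
      have "\<not> J x \<le> 0" for x using J_range[of x] by auto
      then have "{x. J x \<le> i} = {}" using 1 by auto
      then have "prob {x. J x \<le> i} = 0" by (simp only: measure_empty)
      then show ?thesis using 1 by (simp add: F_z_def)
    next
      case 2
      then have "{x. J x \<le> i} = space M" using J_range by (auto intro: order_trans)
      then show ?thesis using 2 by (simp add: F_z_def prob_space[unfolded space_eq_univ])
    next
      case 3
      have "{x. J x \<le> i} = {..z i}"
      proof safe
        fix x assume "J x \<le> i"
        then have "x \<le> z (J x)" "z (J x) \<le> z i" using J1[of x] 3 by (auto intro!: z)
        then show "x \<le> z i" by simp
      qed (use 3 J2 in auto)
      then show ?thesis using 3 by (simp add: F_z_def cdf_def z_def q_def)
    qed
  qed
  have weight: "prob {x. J x = i} = F_z M k v i - F_z M k v (i - 1)" if "i \<in> {1..k}" for i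
  proof -
    have "prob ({x. J x \<le> i} - {x. J x \<le> i - 1}) = prob {x. J x \<le> i} - prob {x. J x \<le> i - 1}"
      by (intro finite_measure_Diff) auto
    moreover have "{x. J x \<le> i} - {x. J x \<le> i - 1} = {x. J x = i}" using that by auto
    ultimately show ?thesis by (simp only: cum)
  qed
  have "nu_Q M k v = discrete_measure k (\<lambda>i. prob {x. J x = i}) q"
    unfolding nu_Q_def q_def[symmetric, abs_def]
    by (rule measure_eqI) (auto simp: emeasure_discrete_measure weight intro!: sum.cong)
  then show ?thesis
    using W1_discrete_nearest[OF k m1 _ J_range J_nearest] by (simp add: q_def[abs_def])
qed

end

section \<open>Quantiles, local density bounds and the convergence rate\<close>

context real_distribution
begin

text \<open>Ensures that the \<open>Inf\<close> in \<open>quantile\<close> is a genuine infimum; on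
  an empty or unbounded set its value would be arbitrary.\<close>

lemma quantile_set:
  assumes p: "0 < p" "p < 1"
  shows "{x. p \<le> cdf M x} \<noteq> {}" and "bdd_below {x. p \<le> cdf M x}"
proof -
  have "\<forall>\<^sub>F x in at_top. p < cdf M x" using order_tendstoD(1)[OF cdf_lim_at_top_prob p(2)] .
  then obtain x where "p < cdf M x" by (auto simp: eventually_at_top_linorder)
  then show "{x. p \<le> cdf M x} \<noteq> {}" by (auto intro: less_imp_le)
  have "\<forall>\<^sub>F x in at_bot. cdf M x < p" using order_tendstoD(2)[OF cdf_lim_at_bot p(1)] .
  then obtain l where "\<And>x. x \<le> l \<Longrightarrow> cdf M x < p" by (auto simp: eventually_at_bot_linorder)
  then have "l \<le> x" if "p \<le> cdf M x" for x using that by (meson linorder_not_le less_imp_le)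
  then show "bdd_below {x. p \<le> cdf M x}" by (intro bdd_belowI[of _ l]) simp
qed

lemma quantile_mono:
  assumes "0 < p" "p \<le> p'" "p' < 1" shows "quantile M p \<le> quantile M p'"
  unfolding quantile_def
  using assms quantile_set[of p] quantile_set[of p'] by (intro cInf_superset_mono) auto

text \<open>Continuity gives both inequalities: the superlevel set is closed and so contains its
  infimum, and the intermediate value theorem puts a point of level exactly \<open>p\<close> into
  it.\<close>

lemma cdf_quantile:
  assumes cont: "continuous_on UNIV (cdf M)" and p: "0 < p" "p < 1"
  shows "cdf M (quantile M p) = p"
proof (rule antisym)
  let ?S = "{x. p \<le> cdf M x}"
  note S = quantile_set[OF p]
  have "closed ?S" using cont by (intro closed_Collect_le continuous_on_const)
  then have "quantile M p \<in> ?S" unfolding quantile_def by (rule closed_contains_Inf[OF S])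
  then show ge: "p \<le> cdf M (quantile M p)" by simp
  have "\<forall>\<^sub>F x in at_bot. cdf M x < p" using order_tendstoD(2)[OF cdf_lim_at_bot p(1)] .
  then obtain l where l: "\<And>x. x \<le> l \<Longrightarrow> cdf M x < p" by (auto simp: eventually_at_bot_linorder)
  obtain u where u: "p \<le> cdf M u" using S(1) by auto
  have lu: "l \<le> u" using l[of u] u by force
  obtain x where x: "cdf M x = p"
    using IVT'[of "cdf M" l p u] l[of l] u lu continuous_on_subset[OF cont] by auto
  have "quantile M p \<le> x" unfolding quantile_def using x S(2) by (intro cInf_lower) auto
  then show "cdf M (quantile M p) \<le> p" using cdf_nondecreasing x by metis
qed

text \<open>The conditions \<open>n1\<close> and \<open>n2\<close> of
  \<open>nn_integral_order_stat_deviation\<close> hold for large \<open>n\<close>, hence the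
  eventual form.\<close>

lemma order_stat_rate:
  assumes p: "0 < p" "p < 1" and q: "cdf M q = p"
    and c: "0 < c" and \<epsilon>: "0 < \<epsilon>" and growth: "\<And>t. c * min \<bar>t - q\<bar> \<epsilon> \<le> \<bar>cdf M t - p\<bar>"
    and fin: "(\<integral>\<^sup>+t. ennreal (sqrt (cdf M t * (1 - cdf M t))) \<partial>lborel) < \<infinity>"
  shows "\<exists>C\<ge>0. \<forall>\<^sub>F n in sequentially.
    (\<integral>\<^sup>+x. ennreal \<bar>order_stat n p x - q\<bar> \<partial>sample n) \<le> ennreal (C / sqrt (real n))"
proof -
  \<comment> \<open>A number in the unit interval is at most its square root, so \<open>fin\<close>
    also controls the integral without the root.\<close>
  have "(\<integral>\<^sup>+t. ennreal (cdf M t * (1 - cdf M t)) \<partial>lborel)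
    \<le> (\<integral>\<^sup>+t. ennreal (sqrt (cdf M t * (1 - cdf M t))) \<partial>lborel)"
    using cdf_variance_bounds
    by (intro nn_integral_mono ennreal_leI real_le_rsqrt) (simp add: power2_eq_square mult_left_le)
  then obtain J where J: "0 \<le> J" "(\<integral>\<^sup>+t. ennreal (cdf M t * (1 - cdf M t)) \<partial>lborel) \<le> ennreal J"
    using fin by (cases "\<integral>\<^sup>+t. ennreal (cdf M t * (1 - cdf M t)) \<partial>lborel") (auto simp: top_unique)
  have "(\<lambda>n. 1 / sqrt (real n)) \<longlonglongrightarrow> 0"
    using tendsto_divide_0[OF tendsto_const filterlim_at_top_imp_at_infinity[OF
        filterlim_compose[OF sqrt_at_top filterlim_real_sequentially]]] .
  then have ev1: "\<forall>\<^sub>F n in sequentially. 1 / sqrt (real n) < c / 2"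
    by (rule order_tendstoD) (use c in simp)
  have "(\<lambda>n. 1 / real n) \<longlonglongrightarrow> 0" by (rule lim_1_over_n)
  then have ev2: "\<forall>\<^sub>F n in sequentially. 1 / real n < c * \<epsilon> / 2"
    by (rule order_tendstoD) (use c \<epsilon> in simp)
  show ?thesis
  proof (intro exI conjI)
    show "0 \<le> 2 + 4 / c\<^sup>2 * (2 + J / \<epsilon>\<^sup>2)" using J(1) by simp
    show "\<forall>\<^sub>F n in sequentially. (\<integral>\<^sup>+x. ennreal \<bar>order_stat n p x - q\<bar> \<partial>sample n)
      \<le> ennreal ((2 + 4 / c\<^sup>2 * (2 + J / \<epsilon>\<^sup>2)) / sqrt (real n))"
      using ev1 ev2 eventually_gt_at_top[of 0]
    proof eventually_elim
      case (elim n)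
      have "2 / real n = 2 * (1 / sqrt (real n)) * (1 / sqrt (real n))" by simp
      also have "\<dots> \<le> c * (1 / sqrt (real n))" using elim by (intro mult_right_mono) auto
      finally have "2 / real n \<le> c / sqrt (real n)" by simp
      moreover have "2 / real n \<le> c * \<epsilon>" using elim(2) by simp
      ultimately show ?case
        using elim(3) J by (intro nn_integral_order_stat_deviation[OF p _ q c \<epsilon> growth]) auto
    qed
  qed
qed

end

section \<open>Consequences of the density for the distribution function and the limiting
  cost\<close>

lemma density_null_outside_interior:
  fixes \<rho> :: "real \<Rightarrow> real"
  assumes I: "is_interval I" "closed I" and [measurable]: "\<rho> \<in> borel_measurable borel"
    and out: "\<And>x. x \<notin> I \<Longrightarrow> \<rho> x = 0" and A [measurable]: "A \<in> sets borel" "A \<inter> interior I = {}"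
  shows "emeasure (density lborel (\<lambda>x. ennreal (\<rho> x))) A = 0"
proof -
  \<comment> \<open>The frontier of an interval is a null set; this disposes of the boundary points
    in \<open>A\<close>, where \<open>\<rho>\<close> may be nonzero.\<close>
  have "frontier I \<in> null_sets lborel"
    using negligible_convex_frontier[of I] is_interval_convex[OF I(1)] negligible_iff_null_sets
      null_sets_completion_iff[of "frontier I" lborel] borel_closed[OF frontier_closed[of I]] by auto
  then have "AE x in lborel. x \<notin> frontier I" by (rule AE_not_in)
  then have "AE x in lborel. ennreal (\<rho> x) * indicator A x = 0"
  proof eventually_elim
    case (elim x)
    then have "x \<notin> I \<or> x \<in> interior I" using I(2) by (auto simp: frontier_def)
    then show ?case using out A(2) by (auto simp: indicator_def)
  qed
  then have "(\<integral>\<^sup>+x. ennreal (\<rho> x) * indicator A x \<partial>lborel) = 0"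
    by (subst nn_integral_0_iff_AE) auto
  then show ?thesis by (simp add: emeasure_density)
qed

text \<open>A point outside the interior has the whole interior, and with it all the mass, on one
  side, which forces \<open>cdf M q\<close> to be 0 or 1.\<close>

lemma cdf_in_01_imp_interior:
  fixes \<rho> :: "real \<Rightarrow> real"
  assumes I: "is_interval I" "closed I" and \<rho>: "\<rho> \<in> borel_measurable borel"
    and out: "\<And>x. x \<notin> I \<Longrightarrow> \<rho> x = 0" and M: "M = density lborel (\<lambda>x. ennreal (\<rho> x))"
    and prob: "real_distribution M" and q: "0 < cdf M q" "cdf M q < 1"
  shows "q \<in> interior I"
proof (rule ccontr)
  assume nq: "q \<notin> interior I"
  interpret real_distribution M by fact
  have conv: "is_interval (interior I)"
    using is_interval_convex[OF I(1)] convex_interior is_interval_convex_1 by blast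
  have "(\<forall>x\<in>interior I. q < x) \<or> (\<forall>x\<in>interior I. x < q)"
  proof (rule ccontr)
    assume "\<not> ?thesis"
    then obtain x y where "x \<in> interior I" "x \<le> q" "y \<in> interior I" "q \<le> y" by (auto simp: not_less)
    then show False using nq mem_is_interval_1_I[OF conv] by blast
  qed
  then show False
  proof
    assume "\<forall>x\<in>interior I. q < x"
    then have "emeasure M {..q} = 0"
      unfolding M by (intro density_null_outside_interior[OF I \<rho> out]) force+
    then show False using q(1) by (simp add: cdf_def emeasure_eq_measure)
  next
    assume "\<forall>x\<in>interior I. x < q"
    then have "emeasure M {q<..} = 0"
      unfolding M by (intro density_null_outside_interior[OF I \<rho> out]) force+
    moreover have "prob {q<..} = 1 - cdf M q"
      using prob_compl[of "{..q}"] by (simp add: cdf_def Compl_eq_Diff_UNIV[symmetric])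
    ultimately show False using q(2) by (simp add: emeasure_eq_measure)
  qed
qed

lemma density_ge_lborel:
  fixes \<rho> :: "real \<Rightarrow> real"
  assumes [measurable]: "\<rho> \<in> borel_measurable borel" "A \<in> sets borel" and c: "0 \<le> c"
    and ge: "\<And>x. x \<in> A \<Longrightarrow> c \<le> \<rho> x"
  shows "ennreal c * emeasure lborel A \<le> emeasure (density lborel (\<lambda>x. ennreal (\<rho> x))) A"
proof -
  have "ennreal c * emeasure lborel A = (\<integral>\<^sup>+x. ennreal c * indicator A x \<partial>lborel)"
    by (simp add: nn_integral_cmult_indicator)
  also have "\<dots> \<le> (\<integral>\<^sup>+x. ennreal (\<rho> x) * indicator A x \<partial>lborel)"
    using ge by (intro nn_integral_mono) (auto simp: indicator_def ennreal_leI)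
  finally show ?thesis by (simp add: emeasure_density)
qed

text \<open>Inside the window the density makes the distribution function grow with slope at least
  \<open>c\<close>; beyond it monotonicity preserves the gain \<open>c * \<epsilon>\<close> reached
  at the edge, hence the minimum.\<close>

lemma cdf_growth:
  fixes \<rho> :: "real \<Rightarrow> real"
  assumes \<rho>: "\<rho> \<in> borel_measurable borel" and M: "M = density lborel (\<lambda>x. ennreal (\<rho> x))"
    and prob: "real_distribution M" and c: "0 < c" and \<epsilon>: "0 < \<epsilon>"
    and ge: "\<And>x. x \<in> {q - \<epsilon>..q + \<epsilon>} \<Longrightarrow> c \<le> \<rho> x"
  shows "c * min \<bar>t - q\<bar> \<epsilon> \<le> \<bar>cdf M t - cdf M q\<bar>"
proof -
  interpret real_distribution M by fact
  have base: "c * (b - a) \<le> cdf M b - cdf M a" if "a \<le> b" "q - \<epsilon> \<le> a" "b \<le> q + \<epsilon>" for a b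
  proof (cases "a = b")
    case False
    then have ab: "a < b" using that by simp
    have "ennreal c * emeasure lborel {a<..b} \<le> emeasure M {a<..b}"
      unfolding M using that c by (intro density_ge_lborel[OF \<rho>] ge) auto
    then have "c * (b - a) \<le> prob {a<..b}"
      using ab c by (simp add: emeasure_eq_measure flip: ennreal_mult)
    then show ?thesis using cdf_diff_eq[OF ab] by simp
  qed simp
  show ?thesis
  proof (cases "q \<le> t")
    case True
    have "c * (min t (q + \<epsilon>) - q) \<le> cdf M (min t (q + \<epsilon>)) - cdf M q"
      using True \<epsilon> by (intro base) auto
    also have "\<dots> \<le> \<bar>cdf M t - cdf M q\<bar>" using cdf_nondecreasing[of "min t (q + \<epsilon>)" t] by simp
    also have "min t (q + \<epsilon>) - q = min \<bar>t - q\<bar> \<epsilon>" using True by (auto simp: min_def)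
    finally show ?thesis .
  next
    case False
    have "c * (q - max t (q - \<epsilon>)) \<le> cdf M q - cdf M (max t (q - \<epsilon>))"
      using False \<epsilon> by (intro base) auto
    also have "\<dots> \<le> \<bar>cdf M t - cdf M q\<bar>" using cdf_nondecreasing[of t "max t (q - \<epsilon>)"] by simp
    also have "q - max t (q - \<epsilon>) = min \<bar>t - q\<bar> \<epsilon>" using False by (auto simp: min_def max_def)
    finally show ?thesis .
  qed
qed

text \<open>The \<open>k\<close> intervals of radius \<open>\<epsilon> / (2 k)\<close> around the points \<open>y j\<close> cover at most half of an
  interval of length \<open>2 \<epsilon>\<close> on which the density is at least \<open>c\<close>.\<close>

lemma expectation_mindist_lower_bound:
  fixes \<rho> :: "real \<Rightarrow> real"
  assumes \<rho>: "\<rho> \<in> borel_measurable borel" and M: "M = density lborel (\<lambda>x. ennreal (\<rho> x))"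
    and prob: "real_distribution M" and c: "0 < c" and \<epsilon>: "0 < \<epsilon>"
    and ge: "\<And>x. x \<in> {q - \<epsilon>..q + \<epsilon>} \<Longrightarrow> c \<le> \<rho> x"
    and k: "1 \<le> k" and m1: "integrable M (\<lambda>x. \<bar>x\<bar>)"
  shows "\<epsilon> / (2 * real k) * (c * \<epsilon>) \<le> (\<integral>x. mindist k y x \<partial>M)"
proof -
  interpret real_distribution M by fact
  define \<eta> where "\<eta> = \<epsilon> / (2 * real k)"
  define U where "U = (\<Union>j\<in>{1..k}. {y j - \<eta><..<y j + \<eta>})"
  define G where "G = {q - \<epsilon>..q + \<epsilon>} - U"
  have \<eta>: "0 < \<eta>" using \<epsilon> k by (simp add: \<eta>_def)
  have [measurable]: "U \<in> sets borel" "G \<in> sets borel" unfolding U_def G_def by measurable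
  have "emeasure lborel U \<le> (\<Sum>j\<in>{1..k}. emeasure lborel {y j - \<eta><..<y j + \<eta>})"
    unfolding U_def by (intro emeasure_subadditive_finite) auto
  also have "\<dots> = (\<Sum>j\<in>{1..k}. ennreal (2 * \<eta>))" using \<eta> by (intro sum.cong) auto
  also have "\<dots> = ennreal \<epsilon>"
    using k \<eta> by (simp add: \<eta>_def ennreal_of_nat_eq_real_of_nat flip: ennreal_mult)
  finally have U: "emeasure lborel U \<le> ennreal \<epsilon>" .
  have "ennreal (2 * \<epsilon>) = emeasure lborel {q - \<epsilon>..q + \<epsilon>}" using \<epsilon> by simp
  also have "\<dots> \<le> emeasure lborel (G \<union> U)" by (intro emeasure_mono) (auto simp: G_def)
  also have "\<dots> \<le> emeasure lborel G + emeasure lborel U" by (intro emeasure_subadditive) auto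
  also have "\<dots> \<le> emeasure lborel G + ennreal \<epsilon>" by (intro add_left_mono U)
  finally have G: "ennreal \<epsilon> \<le> emeasure lborel G"
    using \<epsilon> by (cases "emeasure lborel G") (auto simp flip: ennreal_plus simp: ennreal_le_iff)
  have "ennreal (\<eta> * (c * \<epsilon>)) = ennreal \<eta> * (ennreal c * ennreal \<epsilon>)"
    using c \<epsilon> \<eta> by (simp add: ennreal_mult)
  also have "\<dots> \<le> ennreal \<eta> * (ennreal c * emeasure lborel G)"
    by (intro mult_left_mono G) auto
  also have "\<dots> \<le> ennreal \<eta> * emeasure M G"
    unfolding M using c by (intro mult_left_mono density_ge_lborel[OF \<rho>] ge) (auto simp: G_def)
  also have "\<dots> = (\<integral>\<^sup>+x. ennreal \<eta> * indicator G x \<partial>M)" by (simp add: nn_integral_cmult_indicator)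
  also have "\<dots> \<le> (\<integral>\<^sup>+x. ennreal (mindist k y x) \<partial>M)"
  proof (intro nn_integral_mono)
    fix x
    have "\<eta> \<le> mindist k y x" if "x \<in> G"
      using that by (intro mindist_greatest[OF k]) (force simp: G_def U_def abs_less_iff not_le[symmetric])
    then show "ennreal \<eta> * indicator G x \<le> ennreal (mindist k y x)"
      by (auto simp: indicator_def ennreal_leI)
  qed
  also have "\<dots> = ennreal (\<integral>x. mindist k y x \<partial>M)"
    using mindist_nonneg[OF k] by (intro nn_integral_eq_integral integrable_mindist[OF k m1]) auto
  finally show ?thesis
    using mindist_nonneg[OF k, of y] by (simp add: ennreal_le_iff \<eta>_def)
qed

text \<open>Over the common denominator the numerator is \<open>B * (a - A) + A * (B - b)\<close>,
  and \<open>B / 2 \<le> b\<close> keeps that denominator above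
  \<open>B\<^sup>2 / 2\<close>.\<close>

lemma ratio_deviation:
  fixes a b A B \<alpha> \<beta> :: real
  assumes "\<bar>a - A\<bar> \<le> \<alpha>" "\<bar>b - B\<bar> \<le> \<beta>" "0 \<le> A" "0 < B" "B / 2 \<le> b"
  shows "\<bar>a / b - A / B\<bar> \<le> 2 * (B * \<alpha> + A * \<beta>) / B\<^sup>2"
proof -
  have b: "0 < b" using assms by linarith
  have "a / b - A / B = (B * (a - A) + A * (B - b)) / (b * B)"
    using b assms(4) by (simp add: field_simps)
  then have "\<bar>a / b - A / B\<bar> = \<bar>B * (a - A) + A * (B - b)\<bar> / (b * B)"
    using b assms(4) by (simp add: abs_mult)
  also have "\<dots> \<le> (B * \<alpha> + A * \<beta>) / (b * B)"
  proof (intro divide_right_mono)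
    have "\<bar>B * (a - A) + A * (B - b)\<bar> \<le> B * \<bar>a - A\<bar> + A * \<bar>B - b\<bar>"
      using assms(3,4) abs_triangle_ineq[of "B * (a - A)" "A * (B - b)"] by (simp add: abs_mult)
    also have "\<dots> \<le> B * \<alpha> + A * \<beta>"
      using assms by (intro add_mono mult_left_mono) (auto simp: abs_minus_commute)
    finally show "\<bar>B * (a - A) + A * (B - b)\<bar> \<le> B * \<alpha> + A * \<beta>" .
  qed (use b assms(4) in auto)
  also have "\<dots> \<le> (B * \<alpha> + A * \<beta>) / (B\<^sup>2 / 2)"
  proof (intro divide_left_mono)
    show "B\<^sup>2 / 2 \<le> b * B" using mult_right_mono[OF assms(5), of B] assms(4) by (simp add: power2_eq_square)
    have "0 \<le> \<alpha>" "0 \<le> \<beta>" using assms(1,2) by linarith+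
    then show "0 \<le> B * \<alpha> + A * \<beta>" using assms(3,4) by simp
    show "0 < b * B * (B\<^sup>2 / 2)" using b assms(4) by simp
  qed
  finally show ?thesis by (simp add: mult.commute)
qed

theorem theorem4:
  fixes \<mu> :: "real measure" and \<rho> :: "real \<Rightarrow> real" and I :: "real set"
    and k :: nat and v :: "nat \<Rightarrow> real"
  assumes prob: "prob_space \<mu>"
    and dens: "\<mu> = density lborel (\<lambda>x. ennreal (\<rho> x))"
    and rho_meas: "\<rho> \<in> borel_measurable borel"
    and rho_nonneg: "\<And>x. \<rho> x \<ge> 0"
    and I_interval: "is_interval I" and I_closed: "closed I"
    and rho_out: "\<And>x. x \<notin> I \<Longrightarrow> \<rho> x = 0"
    and rho_pos: "\<And>x. x \<in> interior I \<Longrightarrow> \<rho> x > 0"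
    and rho_diff: "\<rho> differentiable_on I"
    and first_moment: "integrable \<mu> (\<lambda>x. \<bar>x\<bar>)"
    and tail: "compact I \<or> (\<exists>\<delta>>0. integrable \<mu> (\<lambda>x. \<bar>x\<bar> powr (2 + \<delta>)))"
    and k_pos: "1 \<le> k"
    and v_pv: "percentile_vector k v"
    and v_open: "\<forall>j\<in>{1..k}. 0 < v j \<and> v j < 1"
  shows "(\<lambda>n. E_SC_v \<mu> n k v / E_SC_opt \<mu> n k - limit_ratio \<mu> k v) \<in> O(\<lambda>n. 1 / sqrt (real n))
         \<and> (\<exists>C>0. \<forall>n>k. bayes_ar_PM \<mu> n k v \<le> limit_ratio \<mu> k v + C / sqrt (real n))"
proof -
  note [measurable] = rho_meas
  have rd: "real_distribution \<mu>"
    using prob by (auto simp: real_distribution_def real_distribution_axioms_def dens)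
  interpret real_distribution \<mu> by fact
  have AE_I: "AE x in \<mu>. x \<in> I"
    unfolding dens using rho_out by (subst AE_density) (auto intro!: AE_I2, metis less_irrefl)
  obtain \<delta> where \<delta>: "0 < \<delta>" "integrable \<mu> (\<lambda>x. \<bar>x\<bar> powr (2 + \<delta>))"
  proof (cases "compact I")
    case True
    then obtain R where R: "\<And>x. x \<in> I \<Longrightarrow> \<bar>x\<bar> \<le> R"
      using compact_imp_bounded bounded_iff by (metis real_norm_def)
    \<comment> \<open>A bounded support has all moments; the third one serves, with
      \<open>\<delta> = 1\<close>.\<close>
    have "integrable \<mu> (\<lambda>x. \<bar>x\<bar> powr (2 + 1))"
    proof (rule integrable_const_bound[where B = "R powr (2 + 1)"])
      show "AE x in \<mu>. norm (\<bar>x\<bar> powr (2 + 1)) \<le> R powr (2 + 1)"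
        using AE_I
      proof eventually_elim
        case (elim x)
        have "\<bar>x\<bar> powr (2 + 1) \<le> R powr (2 + 1)" using R[OF elim] by (intro powr_mono2) auto
        then show ?case by (simp only: real_norm_def abs_of_nonneg[OF powr_ge_zero])
      qed
    qed measurable
    then show ?thesis using that[of 1] by simp
  qed (use tail that in auto)
  note fin = nn_integral_sqrt_cdf_variance_finite[OF \<delta>]
  then obtain J where J: "0 \<le> J" "(\<integral>\<^sup>+t. ennreal (sqrt (cdf \<mu> t * (1 - cdf \<mu> t))) \<partial>lborel) = ennreal J"
    by (cases "\<integral>\<^sup>+t. ennreal (sqrt (cdf \<mu> t * (1 - cdf \<mu> t))) \<partial>lborel") auto

  \<comment> \<open>Quantiles and windows of positive density around them\<close>
  define q where "q j = quantile \<mu> (v j)" for j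
  have v: "0 < v j" "v j < 1" if "j \<in> {1..k}" for j using v_open that by auto
  have "measure \<mu> {x} = 0" for x
    unfolding dens by (simp add: measure_def emeasure_density nn_integral_0_iff_AE)
  then have cont: "continuous_on UNIV (cdf \<mu>)"
    by (auto simp: continuous_on_eq_continuous_at isCont_cdf)
  have cdf_q: "cdf \<mu> (q j) = v j" if "j \<in> {1..k}" for j
    unfolding q_def by (rule cdf_quantile[OF cont v[OF that]])
  \<comment> \<open>Since \<open>0 < v j < 1\<close>, the quantile is interior to \<open>I\<close>,
    where \<open>\<rho>\<close> is continuous and positive. Half its value there is a lower bound on
    a neighbourhood; halving the radius gives a closed window inside it.\<close>
  have lower: "\<exists>c>0. \<exists>\<epsilon>>0. \<forall>x\<in>{q j - \<epsilon>..q j + \<epsilon>}. c \<le> \<rho> x" if j: "j \<in> {1..k}" for j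
  proof -
    have q_int: "q j \<in> interior I"
      using cdf_q[OF j] v[OF j]
      by (intro cdf_in_01_imp_interior[OF I_interval I_closed rho_meas rho_out dens rd]) auto
    then have "isCont \<rho> (q j)"
      using continuous_on_interior[OF differentiable_imp_continuous_on[OF rho_diff]] by simp
    then have "\<forall>\<^sub>F x in nhds (q j). \<rho> (q j) / 2 < \<rho> x"
      using rho_pos[OF q_int] by (intro order_tendstoD) (auto simp: isCont_def tendsto_nhds_iff)
    then obtain d where d: "0 < d" "\<And>x. dist x (q j) < d \<Longrightarrow> \<rho> (q j) / 2 < \<rho> x"
      by (auto simp: eventually_nhds_metric)
    have "\<forall>x\<in>{q j - d / 2..q j + d / 2}. \<rho> (q j) / 2 \<le> \<rho> x"
      using d(1) by (intro ballI less_imp_le d(2)) (auto simp: dist_real_def)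
    then show ?thesis
      using d(1) rho_pos[OF q_int]
      by (intro exI[of _ "\<rho> (q j) / 2"] conjI exI[of _ "d / 2"]) auto
  qed

  \<comment> \<open>The limiting costs \<open>A\<close> and \<open>B\<close>\<close>
  define B where "B = enn2real (INF \<nu>\<in>Pk k. W1 \<mu> \<nu>)"
  define A where "A = (\<integral>x. mindist k q x \<partial>\<mu>)"
  have E_nonneg: "0 \<le> (\<integral>x. mindist k y x \<partial>\<mu>)" for y
    using mindist_nonneg[OF k_pos] by (intro integral_nonneg_AE) auto
  have INF_le: "(INF \<nu>\<in>Pk k. W1 \<mu> \<nu>) \<le> ennreal (\<integral>x. mindist k y x \<partial>\<mu>)" for y
    unfolding INF_W1_Pk[OF k_pos first_moment] by (rule INF_lower) simp
  \<comment> \<open>Finiteness matters here, as \<open>enn2real\<close> would send an infinite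
    infimum to 0.\<close>
  then have B_eq: "ennreal B = (INF \<nu>\<in>Pk k. W1 \<mu> \<nu>)"
    unfolding B_def by (intro ennreal_enn2real) (meson ennreal_less_top le_less_trans)
  have B_le: "B \<le> (\<integral>x. mindist k y x \<partial>\<mu>)" for y
    using INF_le[of y] E_nonneg[of y] by (simp add: B_eq[symmetric] ennreal_le_iff)
  have B_ge: "b \<le> B" if "\<And>y. b \<le> (\<integral>x. mindist k y x \<partial>\<mu>)" for b
  proof -
    have "ennreal b \<le> ennreal B"
      unfolding B_eq INF_W1_Pk[OF k_pos first_moment] using that by (intro INF_greatest ennreal_leI)
    then show ?thesis by (simp add: ennreal_le_iff B_def)
  qed
  have B_pos: "0 < B"
  proof -
    obtain c \<epsilon> where c: "0 < c" "0 < \<epsilon>" "\<And>x. x \<in> {q 1 - \<epsilon>..q 1 + \<epsilon>} \<Longrightarrow> c \<le> \<rho> x"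
      using lower[of 1] k_pos by auto
    \<comment> \<open>The bound is uniform in \<open>y\<close> and therefore passes to the infimum;
      the window around the first quantile is chosen.\<close>
    have "\<epsilon> / (2 * real k) * (c * \<epsilon>) \<le> B"
      using c(3)
      by (intro B_ge expectation_mindist_lower_bound[OF rho_meas dens rd c(1,2) _ k_pos first_moment])
    moreover have "0 < \<epsilon> / (2 * real k) * (c * \<epsilon>)" using c k_pos by simp
    ultimately show ?thesis by linarith
  qed
  have q_mono: "quantile \<mu> (v i) \<le> quantile \<mu> (v j)" if "1 \<le> i" "i \<le> j" "j \<le> k" for i j
    using that v[of i] v[of j] v_pv by (intro quantile_mono) (auto simp: percentile_vector_def)
  have limit: "limit_ratio \<mu> k v = A / B"
    using W1_nu_Q[OF k_pos first_moment q_mono] E_nonneg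
    by (simp add: limit_ratio_def A_def B_def q_def[abs_def])

  \<comment> \<open>Rates for numerator, denominator and ratio\<close>
  have "\<exists>C\<ge>0. \<forall>\<^sub>F n in sequentially.
    (\<integral>\<^sup>+x. ennreal \<bar>order_stat n (v j) x - q j\<bar> \<partial>sample n) \<le> ennreal (C / sqrt (real n))"
    if j: "j \<in> {1..k}" for j
  proof -
    obtain c \<epsilon> where c: "0 < c" "0 < \<epsilon>" "\<And>x. x \<in> {q j - \<epsilon>..q j + \<epsilon>} \<Longrightarrow> c \<le> \<rho> x"
      using lower[OF j] by auto
    have "c * min \<bar>t - q j\<bar> \<epsilon> \<le> \<bar>cdf \<mu> t - v j\<bar>" for t
      unfolding cdf_q[OF j, symmetric] using c(3) by (rule cdf_growth[OF rho_meas dens rd c(1,2)])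
    then show ?thesis
      by (intro order_stat_rate[OF v[OF j] cdf_q[OF j] c(1,2) _ fin])
  qed
  then have "\<forall>j\<in>{1..k}. \<exists>C. 0 \<le> C \<and> (\<forall>\<^sub>F n in sequentially.
    (\<integral>\<^sup>+x. ennreal \<bar>order_stat n (v j) x - q j\<bar> \<partial>sample n) \<le> ennreal (C / sqrt (real n)))"
    by blast
  from bchoice[OF this] obtain C where C: "\<And>j. j \<in> {1..k} \<Longrightarrow> 0 \<le> C j"
    and ev: "\<And>j. j \<in> {1..k} \<Longrightarrow> \<forall>\<^sub>F n in sequentially.
      (\<integral>\<^sup>+x. ennreal \<bar>order_stat n (v j) x - q j\<bar> \<partial>sample n) \<le> ennreal (C j / sqrt (real n))"
    by blast
  have ev_all: "\<forall>\<^sub>F n in sequentially. \<forall>j\<in>{1..k}.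
      (\<integral>\<^sup>+x. ennreal \<bar>order_stat n (v j) x - q j\<bar> \<partial>sample n) \<le> ennreal (C j / sqrt (real n))"
    using ev by (intro eventually_ball_finite) auto
  have "(\<lambda>n. J / sqrt (real n)) \<longlonglongrightarrow> 0"
    using tendsto_divide_0[OF tendsto_const filterlim_at_top_imp_at_infinity[OF
        filterlim_compose[OF sqrt_at_top filterlim_real_sequentially]]] .
  \<comment> \<open>Keeps the expected optimal cost above \<open>B / 2\<close>, as
    \<open>ratio_deviation\<close> demands.\<close>
  then have ev_J: "\<forall>\<^sub>F n in sequentially. J / sqrt (real n) < B / 2"
    by (rule order_tendstoD) (use B_pos in simp)

  define D where "D = (\<Sum>j\<in>{1..k}. C j)"
  \<comment> \<open>The constant of \<open>ratio_deviation\<close> for numerator error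
    \<open>D / sqrt n\<close> and denominator error \<open>J / sqrt n\<close>.\<close>
  define K where "K = 2 * (B * D + A * J) / B\<^sup>2"
  have A0: "0 \<le> A" and D0: "0 \<le> D" using E_nonneg C by (auto simp: A_def D_def intro!: sum_nonneg)
  have K0: "0 \<le> K" using A0 D0 J(1) B_pos by (simp add: K_def)
  have rate: "\<forall>\<^sub>F n in sequentially.
    \<bar>E_SC_v \<mu> n k v / E_SC_opt \<mu> n k - A / B\<bar> \<le> K * (1 / sqrt (real n))"
    using ev_all ev_J eventually_gt_at_top[of 0]
  proof eventually_elim
    case (elim n)
    have a: "\<bar>E_SC_v \<mu> n k v - A\<bar> \<le> D / sqrt (real n)"
      unfolding A_def D_def sum_divide_distrib using elim(1,3) v C
      by (intro E_SC_v_deviation[OF k_pos _ first_moment]) auto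
    have lo: "B - J / sqrt (real n) \<le> E_SC_opt \<mu> n k"
      using elim(3) J B_le by (intro E_SC_opt_bounds(2)[OF k_pos _ first_moment]) auto
    have up: "E_SC_opt \<mu> n k \<le> B"
      using E_SC_opt_bounds(1)[OF k_pos elim(3) first_moment] by (intro B_ge)
    have "\<bar>E_SC_v \<mu> n k v / E_SC_opt \<mu> n k - A / B\<bar>
      \<le> 2 * (B * (D / sqrt (real n)) + A * (J / sqrt (real n))) / B\<^sup>2"
      using a lo up elim(2) A0 B_pos by (intro ratio_deviation) auto
    also have "\<dots> = K * (1 / sqrt (real n))"
      by (simp add: K_def add_divide_distrib[symmetric])
    finally show ?case .
  qed
  have bigo: "(\<lambda>n. E_SC_v \<mu> n k v / E_SC_opt \<mu> n k - limit_ratio \<mu> k v) \<in> O(\<lambda>n. 1 / sqrt (real n))"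
    using rate by (intro bigoI[of _ K]) (simp add: limit)

  \<comment> \<open>One constant for all \<open>n > k\<close>\<close>
  obtain N where N: "\<And>n. N \<le> n \<Longrightarrow> \<bar>bayes_ar_PM \<mu> n k v - A / B\<bar> \<le> K / sqrt (real n)"
    using rate by (auto simp: eventually_sequentially bayes_ar_PM_def)
  \<comment> \<open>The finitely many \<open>n\<close> below \<open>N\<close> are absorbed by
    summing their scaled deviations; the later \<open>+ 1\<close> makes the constant strictly
    positive.\<close>
  define S where "S = (\<Sum>n<N. \<bar>bayes_ar_PM \<mu> n k v - A / B\<bar> * sqrt (real n))"
  have S0: "0 \<le> S" by (simp add: S_def sum_nonneg)
  have "bayes_ar_PM \<mu> n k v \<le> limit_ratio \<mu> k v + (K + S + 1) / sqrt (real n)" if n: "k < n" for n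
  proof -
    have pos: "0 < sqrt (real n)" using n by simp
    have "\<bar>bayes_ar_PM \<mu> n k v - A / B\<bar> * sqrt (real n) \<le> K + S"
    proof (cases "N \<le> n")
      case True
      then have "\<bar>bayes_ar_PM \<mu> n k v - A / B\<bar> * sqrt (real n) \<le> K"
        using N[OF True] pos by (simp add: pos_le_divide_eq)
      then show ?thesis using S0 by simp
    next
      case False
      then have "\<bar>bayes_ar_PM \<mu> n k v - A / B\<bar> * sqrt (real n) \<le> S"
        unfolding S_def by (intro member_le_sum) auto
      then show ?thesis using K0 by simp
    qed
    then have "\<bar>bayes_ar_PM \<mu> n k v - A / B\<bar> \<le> (K + S + 1) / sqrt (real n)"
      using pos by (simp add: pos_le_divide_eq)
    then show ?thesis unfolding limit by linarith
  qed
  moreover have "0 < K + S + 1" using K0 S0 by simp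
  ultimately show ?thesis using bigo by blast
qed

end
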